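(* Let $X$ be a compact metrizable space and let $T:X\to X$ be a homeomorphism. Assume that $(X,T)$ has finite topological multiplicity, i.e. $\mathrm{Mult}(T)<\infty$. Then the following properties hold: (1) $(X,T)$ has zero topological entropy; (2) $(X,T)$ has only finitely many ergodic invariant Borel probability measures.
   Context: $C(X)$ denotes the Banach space of real-valued continuous functions on $X$ with the supremum norm. The topological multiplicity $\mathrm{Mult}(T)\in\mathbb N\cup\{\infty\}$ is the smallest cardinality of a set $F\subset C(X)$ such that the linear span of $\{f\circ T^n: f\in F,\ n\in\mathbb Z\}$ is dense in $C(X)$; it equals $\infty$ if no finite such set exists. *)

theory Defs
  imports "HOL-Probability.Probability"
begin

definition int_iterate :: "('a \<Rightarrow> 'a) \<Rightarrow> int \<Rightarrow> 'a \<Rightarrow> 'a" where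
  "int_iterate T n = (if n \<ge> 0 then T ^^ nat n else inv T ^^ nat (- n))"

text \<open>For compact \<open>X\<close> the type \<open>X \<Rightarrow>\<^sub>C real\<close> of bounded continuous functions is
  the Banach space \<open>C(X)\<close> with the supremum norm. The translates \<open>f \<circ> T\<^sup>n\<close> are described
  through their underlying functions; if \<open>T\<close> is a homeomorphism, then for all \<open>f\<close> and \<open>n\<close>
  there is exactly one such \<open>g\<close>.\<close>

definition translates ::
  "('a::topological_space \<Rightarrow> 'a) \<Rightarrow> ('a \<Rightarrow>\<^sub>C real) set \<Rightarrow> ('a \<Rightarrow>\<^sub>C real) set" where
  "translates T F =
     {g. \<exists>f\<in>F. \<exists>n::int. apply_bcontfun g = apply_bcontfun f \<circ> int_iterate T n}"

definition top_mult :: "('a::topological_space \<Rightarrow> 'a) \<Rightarrow> enat" where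
  "top_mult T =
     (INF F \<in> {F. closure (span (translates T F)) = UNIV}.
        if finite F then enat (card F) else \<infinity>)"

text \<open>Topological entropy in the sense of Adler, Konheim and McAndrew, with the natural logarithm.
  By subadditivity the \<open>limsup\<close> below is a limit when the space is compact and \<open>T\<close> is
  continuous.\<close>

definition open_cover :: "'a::topological_space set set \<Rightarrow> bool" where
  "open_cover \<U> \<longleftrightarrow> (\<forall>U\<in>\<U>. open U) \<and> \<Union>\<U> = UNIV"

definition cover_number :: "'a set set \<Rightarrow> nat" where
  "cover_number \<U> = (LEAST k. \<exists>\<V>\<subseteq>\<U>. finite \<V> \<and> \<Union>\<V> = UNIV \<and> card \<V> = k)"

text \<open>The join of \<open>\<U>, T\<^sup>-\<^sup>1 \<U>, \<dots>, T\<^sup>-\<^sup>(\<^sup>n\<^sup>-\<^sup>1\<^sup>) \<U>\<close>.\<close>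

definition iterated_join :: "('a \<Rightarrow> 'a) \<Rightarrow> 'a set set \<Rightarrow> nat \<Rightarrow> 'a set set" where
  "iterated_join T \<U> n = {\<Inter>i<n. (T ^^ i) -` A i | A. \<forall>i<n. A i \<in> \<U>}"

definition cover_entropy :: "('a \<Rightarrow> 'a) \<Rightarrow> 'a set set \<Rightarrow> ereal" where
  "cover_entropy T \<U> =
     limsup (\<lambda>n. ereal (ln (real (cover_number (iterated_join T \<U> n))) / real n))"

definition top_entropy :: "('a::topological_space \<Rightarrow> 'a) \<Rightarrow> ereal" where
  "top_entropy T = (SUP \<U> \<in> {\<U>. open_cover \<U>}. cover_entropy T \<U>)"

definition invariant_borel_prob ::
  "('a::topological_space \<Rightarrow> 'a) \<Rightarrow> 'a measure \<Rightarrow> bool" where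
  "invariant_borel_prob T \<mu> \<longleftrightarrow>
     sets \<mu> = sets borel \<and> prob_space \<mu> \<and>
     (\<forall>A\<in>sets borel. emeasure \<mu> (T -` A) = emeasure \<mu> A)"

definition ergodic_borel_prob ::
  "('a::topological_space \<Rightarrow> 'a) \<Rightarrow> 'a measure \<Rightarrow> bool" where
  "ergodic_borel_prob T \<mu> \<longleftrightarrow>
     invariant_borel_prob T \<mu> \<and>
     (\<forall>A\<in>sets borel. T -` A = A \<longrightarrow> emeasure \<mu> A = 0 \<or> emeasure \<mu> A = 1)"

end

theory Submission
  imports Defs "HOL-Real_Asymp.Real_Asymp"
begin

text \<open>Suppose that the translates of \<open>N\<close> functions span a dense subspace.

  Ergodic measures: among more than \<open>N\<close> ergodic measures there would be a nontrivial linear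
  combination vanishing on the generators, hence on all of \<open>C(X)\<close>, while distinct ergodic
  measures are mutually singular.

  Entropy: if some open cover has positive entropy, Pajor's form of the Sauer-Shelah lemma gives,
  for infinitely many \<open>n\<close>, a set \<open>W \<subseteq> {0..<n}\<close> of size at least \<open>d n\<close> and a function \<open>g\<close>, taken from a finite
  collection not depending on \<open>n\<close>, such that all sign patterns on \<open>W\<close> occur
  as \<open>j \<mapsto> g (T\<^sup>j x)\<close>. The functions \<open>(g \<circ> T\<^sup>u) \<cdot> (g \<circ> T\<^sup>v)\<close> with \<open>u < v < u + L\<close> in \<open>W\<close> are then
  orthonormal with respect to the uniform measure on points realising these patterns. They are
  translates of finitely many functions, so all of them are uniformly close to
  the span of \<open>N (n + O(1))\<close> vectors; but for large \<open>L\<close> there are more than \<open>2 N n\<close> of them.\<close>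

section \<open>Combinatorics and linear algebra\<close>

definition shatters :: "'a set set \<Rightarrow> 'a set \<Rightarrow> bool" where
  "shatters S W \<longleftrightarrow> (\<forall>V\<subseteq>W. \<exists>A\<in>S. A \<inter> W = V)"

text \<open>Pajor's lemma. Remove \<open>z\<close> and split \<open>S\<close> into the sets without
  \<open>z\<close> and the traces of those with \<open>z\<close>. A set shattered by either family
  is shattered by \<open>S\<close>, and a set \<open>W\<close> shattered by both yields
  \<open>insert z W\<close> as well, so the two counts add up.\<close>

lemma card_le_card_shattered:
  assumes "finite Z" "S \<subseteq> Pow Z"
  shows "card S \<le> card {W. W \<subseteq> Z \<and> shatters S W}"
  using assms
proof (induction Z arbitrary: S rule: finite_induct)
  case empty
  then have "S = {} \<or> S = {{}}" by auto
  then show ?case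
  proof
    assume "S = {{}}"
    then have "{W. W \<subseteq> {} \<and> shatters S W} = {{}}" by (auto simp: shatters_def)
    with \<open>S = {{}}\<close> show ?thesis by simp
  qed simp
next
  case (insert z Z)
  define S0 where "S0 = {A\<in>S. z \<notin> A}"
  define S1 where "S1 = {A\<in>S. z \<in> A}"
  define S1' where "S1' = (\<lambda>A. A - {z}) ` S1"
  define D0 where "D0 = {W. W \<subseteq> Z \<and> shatters S0 W}"
  define D1 where "D1 = {W. W \<subseteq> Z \<and> shatters S1' W}"
  have finS: "finite S" using insert by (meson finite_Pow_iff finite_insert finite_subset)
  have "inj_on (\<lambda>A. A - {z}) S1" by (auto simp: inj_on_def S1_def)
  then have c1: "card S1' = card S1" by (simp add: S1'_def card_image)
  have "S = S0 \<union> S1" "S0 \<inter> S1 = {}" by (auto simp: S0_def S1_def)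
  then have cS: "card S = card S0 + card S1"
    using finS by (metis card_Un_disjoint finite_Un)
  have "card S0 \<le> card D0" unfolding D0_def
    by (rule insert.IH) (use insert.prems in \<open>auto simp: S0_def\<close>)
  moreover have "card S1' \<le> card D1" unfolding D1_def
    by (rule insert.IH) (use insert.prems in \<open>auto simp: S1'_def S1_def\<close>)
  ultimately have le: "card S \<le> card D0 + card D1" using cS c1 by simp
  have finD: "finite D0" "finite D1"
    using insert.hyps by (auto simp: D0_def D1_def)
  have sub: "(D0 \<union> D1) \<union> insert z ` (D0 \<inter> D1) \<subseteq> {W. W \<subseteq> insert z Z \<and> shatters S W}"
  proof -
    have "shatters S W" if "W \<in> D0" for W
      using that unfolding D0_def S0_def shatters_def by blast
    moreover have "shatters S W" if W: "W \<in> D1" for W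
      unfolding shatters_def
    proof (intro allI impI)
      fix V assume "V \<subseteq> W"
      then obtain A where "A \<in> S1'" "A \<inter> W = V"
        using W unfolding D1_def shatters_def by blast
      then obtain B where "B \<in> S1" "A = B - {z}" by (auto simp: S1'_def)
      moreover have "z \<notin> W" using that insert.hyps by (auto simp: D1_def)
      ultimately show "\<exists>A\<in>S. A \<inter> W = V"
        using \<open>A \<inter> W = V\<close> by (intro bexI[of _ B]) (auto simp: S1_def)
    qed
    moreover have "shatters S (insert z W)" if W: "W \<in> D0" "W \<in> D1" for W
      unfolding shatters_def
    proof (intro allI impI)
      fix V assume V: "V \<subseteq> insert z W"
      have zW: "z \<notin> W" using that insert.hyps by (auto simp: D1_def)
      show "\<exists>A\<in>S. A \<inter> insert z W = V"
      proof (cases "z \<in> V")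
        case True
        have "V - {z} \<subseteq> W" using V by auto
        then obtain A where "A \<in> S1'" and A: "A \<inter> W = V - {z}"
          using W(2) unfolding D1_def shatters_def by blast
        then obtain B where "B \<in> S1" "A = B - {z}" by (auto simp: S1'_def)
        then show ?thesis using A zW True
          by (intro bexI[of _ B]) (auto simp: S1_def)
      next
        case False
        then have "V \<subseteq> W" using V by auto
        then obtain A where "A \<in> S0" and A: "A \<inter> W = V"
          using W(1) unfolding D0_def shatters_def by blast
        then show ?thesis using False
          by (intro bexI[of _ A]) (auto simp: S0_def)
      qed
    qed
    ultimately show ?thesis by (auto simp: D0_def D1_def)
  qed
  have disj: "(D0 \<union> D1) \<inter> insert z ` (D0 \<inter> D1) = {}"
    using insert.hyps by (auto simp: D0_def D1_def)
  have "inj_on (insert z) (D0 \<inter> D1)"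
    using insert.hyps(2) unfolding inj_on_def D0_def by (metis (no_types, lifting) IntD1 insert_ident mem_Collect_eq subsetD)
  then have "card ((D0 \<union> D1) \<union> insert z ` (D0 \<inter> D1)) = card (D0 \<union> D1) + card (D0 \<inter> D1)"
    using finD disj by (subst card_Un_disjoint) (auto simp: card_image)
  also have "\<dots> = card D0 + card D1"
    using finD card_Un_Int by metis
  finally have "card D0 + card D1 \<le> card {W. W \<subseteq> insert z Z \<and> shatters S W}"
    using sub insert.hyps by (metis (no_types, lifting) card_mono finite_Collect_subsets finite_insert finite_subset mem_Collect_eq subsetI)
  with le show ?case by simp
qed

lemma sum_power_card_Pow:
  fixes x :: real
  assumes "finite Z"
  shows "(\<Sum>Q\<in>Pow Z. x ^ card Q) = (1 + x) ^ card Z"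
  using prod_add[OF assms, of "\<lambda>_. x" "\<lambda>_. 1"] by (simp add: add.commute)

text \<open>An exponential weight replaces estimates of binomial coefficients: give \<open>Q\<close>
  the weight \<open>x ^ card Q\<close> with \<open>0 < x < 1\<close>. Small sets have large weight,
  while the total weight is only \<open>(1 + x) ^ n\<close>.\<close>

lemma few_small_subsets:
  fixes a :: real
  assumes "a > 0"
  obtains d :: real where "d > 0" "\<And>n. real (card {Q. Q \<subseteq> {..<n::nat} \<and> card Q \<le> d * n}) \<le> exp (a * n)"
proof -
  define x where "x = min (a/2) (1/2)"
  have x: "0 < x" "x < 1" "x \<le> a/2" using assms by (auto simp: x_def)
  \<comment> \<open>Chosen so that \<open>x\<close> to the power \<open>d * n\<close> is
    \<open>exp (- a/2 * n)\<close>; the bound \<open>x \<le> a/2\<close> keeps the total weight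
    below \<open>exp (a/2 * n)\<close>.\<close>
  define d where "d = a / 2 / ln (1/x)"
  have lnx: "ln (1/x) > 0" using x by simp
  have d: "d > 0" using lnx assms by (simp add: d_def)
  have dl: "d * ln x = - a/2" using lnx x by (simp add: d_def ln_div field_simps)
  have "real (card {Q. Q \<subseteq> {..<n::nat} \<and> card Q \<le> d * n}) \<le> exp (a * n)" for n
  proof -
    let ?A = "{Q. Q \<subseteq> {..<n::nat} \<and> card Q \<le> d * n}"
    have "real (card ?A) * exp (- a/2 * n) = (\<Sum>Q\<in>?A. exp (- a/2 * n))" by simp
    also have "\<dots> \<le> (\<Sum>Q\<in>?A. x ^ card Q)"
    proof (rule sum_mono)
      fix Q assume "Q \<in> ?A"
      then have "real (card Q) \<le> d * n" by simp
      then have "d * n * ln x \<le> card Q * ln x"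
        using x by (intro mult_right_mono_neg) auto
      then have "- a/2 * n \<le> card Q * ln x" using dl
        by (metis mult.commute mult.left_commute)
      then have "exp (- a/2 * n) \<le> exp (card Q * ln x)" by simp
      also have "\<dots> = x ^ card Q" using x by (simp add: exp_of_nat_mult)
      finally show "exp (- a/2 * n) \<le> x ^ card Q" .
    qed
    also have "\<dots> \<le> (\<Sum>Q\<in>Pow {..<n}. x ^ card Q)"
      using x by (intro sum_mono2) auto
    also have "\<dots> = (1 + x) ^ n" by (simp add: sum_power_card_Pow)
    also have "\<dots> \<le> exp (a/2) ^ n"
      using x exp_ge_add_one_self[of "a/2"] by (intro power_mono) linarith+
    also have "\<dots> = exp (a/2 * n)" by (metis exp_of_nat_mult mult.commute)
    finally have "real (card ?A) * exp (- a/2 * n) * exp (a/2 * n) \<le> exp (a/2 * n) * exp (a/2*n)"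
      by (intro mult_right_mono) auto
    then show ?thesis by (simp add: mult.assoc flip: exp_add)
  qed
  with d show thesis by (rule that)
qed

text \<open>Call \<open>u\<close> sparse if fewer than \<open>r\<close> elements of \<open>W\<close>
  follow it within distance \<open>L\<close>. A block of length \<open>L\<close> has at most
  \<open>r\<close> sparse points, since the smallest of them is followed closely by all the others.
  Every point that is not sparse starts at least \<open>r\<close> pairs.\<close>

lemma close_pairs:
  fixes W :: "nat set" and L r n :: nat
  assumes W: "W \<subseteq> {..<n}" and L: "L > 0"
  shows "r * card W \<le> card {(u,v). u \<in> W \<and> v \<in> W \<and> u < v \<and> v < u + L} + r * r * (n div L + 1)"
proof -
  define nb where "nb u = {v\<in>W. u < v \<and> v < u + L}" for u
  define sp where "sp = {u\<in>W. card (nb u) < r}"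
  have finW: "finite W" using W finite_subset by blast
  have fibre: "card {u\<in>sp. u div L = i} \<le> r" for i
  proof (rule ccontr)
    let ?\<Phi> = "{u\<in>sp. u div L = i}"
    assume "\<not> card ?\<Phi> \<le> r"
    have fin: "finite ?\<Phi>" using finW by (auto simp: sp_def)
    with \<open>\<not> card ?\<Phi> \<le> r\<close> have ne: "?\<Phi> \<noteq> {}"
      by (metis (no_types, lifting) card.empty zero_le)
    define u where "u = Min ?\<Phi>"
    have u: "u \<in> ?\<Phi>" using Min_in[OF fin ne] by (simp add: u_def)
    have "?\<Phi> - {u} \<subseteq> nb u"
    proof
      fix v assume v: "v \<in> ?\<Phi> - {u}"
      then have "u < v" using Min_le[OF fin, of v] by (auto simp: u_def)
      moreover have "v < u + L"
      proof -
        have "v div L = u div L" using u v by simp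
        then have "v = u div L * L + v mod L" by (metis div_mult_mod_eq)
        moreover have "u = u div L * L + u mod L" by simp
        moreover have "v mod L < L" using L by simp
        ultimately show ?thesis by linarith
      qed
      ultimately show "v \<in> nb u" using v by (auto simp: nb_def sp_def)
    qed
    then have "card (?\<Phi> - {u}) \<le> card (nb u)" using finW by (intro card_mono) (auto simp: nb_def)
    moreover have "card (nb u) < r" using u by (simp add: sp_def)
    ultimately show False using \<open>\<not> card ?\<Phi> \<le> r\<close> u fin by simp
  qed
  have "u div L \<le> n div L" if "u \<in> sp" for u
    using that W by (intro div_le_mono) (auto simp: sp_def)
  then have "sp \<subseteq> (\<Union>i\<in>{..n div L}. {u\<in>sp. u div L = i})" by auto
  then have "card sp \<le> card (\<Union>i\<in>{..n div L}. {u\<in>sp. u div L = i})"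
    using finW by (intro card_mono) (auto simp: sp_def)
  also have "\<dots> \<le> (\<Sum>i\<in>{..n div L}. card {u\<in>sp. u div L = i})"
    by (intro card_UN_le) simp
  also have "\<dots> \<le> (\<Sum>i\<in>{..n div L}. r)" by (intro sum_mono fibre)
  finally have sp: "card sp \<le> r * (n div L + 1)" by (simp add: mult.commute)
  have "{(u,v). u \<in> W \<and> v \<in> W \<and> u < v \<and> v < u + L} = (SIGMA u:W. nb u)"
    by (auto simp: nb_def)
  then have "card {(u,v). u \<in> W \<and> v \<in> W \<and> u < v \<and> v < u + L} = (\<Sum>u\<in>W. card (nb u))"
    using finW by (simp add: nb_def)
  also have "\<dots> \<ge> (\<Sum>u\<in>W - sp. card (nb u))"
    using finW by (intro sum_mono2) auto
  moreover have "(\<Sum>u\<in>W - sp. card (nb u)) \<ge> (\<Sum>u\<in>W - sp. r)"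
    by (intro sum_mono) (auto simp: sp_def)
  moreover have "(\<Sum>u\<in>W - sp. r) = r * (card W - card sp)"
    using finW by (simp add: sp_def card_Diff_subset)
  ultimately have "r * (card W - card sp) \<le> card {(u,v). u \<in> W \<and> v \<in> W \<and> u < v \<and> v < u + L}"
    by linarith
  moreover have "r * card W \<le> r * (card W - card sp) + r * card sp"
    by (subst add_mult_distrib2[symmetric]) (rule mult_le_mono2, linarith)
  moreover have "r * card sp \<le> r * r * (n div L + 1)"
    by (metis mult.assoc mult_le_mono2 sp)
  ultimately show ?thesis by linarith
qed

text \<open>Gaussian elimination with equations \<open>F\<close> and unknowns \<open>E\<close>: one
  equation is used to remove one unknown.\<close>

lemma homogeneous_system_nontrivial:
  fixes a :: "'f \<Rightarrow> 'e \<Rightarrow> real"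
  assumes "finite F" "finite E" "card F < card E"
  obtains c where "\<exists>e\<in>E. c e \<noteq> 0" "\<And>f. f \<in> F \<Longrightarrow> (\<Sum>e\<in>E. c e * a f e) = 0"
proof -
  have "\<exists>c. (\<exists>e\<in>E. c e \<noteq> 0) \<and> (\<forall>f\<in>F. (\<Sum>e\<in>E. c e * a f e) = 0)"
    using assms
  proof (induction F arbitrary: E a rule: finite_induct)
    case empty
    then obtain e where "e \<in> E" by fastforce
    then show ?case by (intro exI[of _ "\<lambda>_. 1"]) auto
  next
    case (insert f F)
    show ?case
    proof (cases "\<forall>e\<in>E. a f e = 0")
      case True
      with insert.IH[of E a] insert.prems insert.hyps show ?thesis by auto
    next
      case False
      then obtain e0 where e0: "e0 \<in> E" "a f e0 \<noteq> 0" by auto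
      define E' where "E' = E - {e0}"
      have E': "finite E'" "E = insert e0 E'" "e0 \<notin> E'"
        using insert.prems e0 by (auto simp: E'_def)
      \<comment> \<open>The coefficients after equation \<open>f\<close> has been solved for the
        unknown \<open>e0\<close> and substituted into the others.\<close>
      define a' where "a' g e = a g e - a g e0 * a f e / a f e0" for g e
      have "card F < card E'" using insert.prems insert.hyps E' by simp
      then obtain c' where c': "\<exists>e\<in>E'. c' e \<noteq> 0" "\<forall>g\<in>F. (\<Sum>e\<in>E'. c' e * a' g e) = 0"
        using insert.IH[of E' a'] E' by auto
      define s where "s = (\<Sum>e\<in>E'. c' e * a f e) / a f e0"
      define c where "c = c'(e0 := - s)"
      have cs: "(\<Sum>e\<in>E. c e * a g e) = - s * a g e0 + (\<Sum>e\<in>E'. c' e * a g e)" for g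
      proof -
        have "(\<Sum>e\<in>E'. c e * a g e) = (\<Sum>e\<in>E'. c' e * a g e)"
          using E'(3) by (intro sum.cong) (auto simp: c_def)
        then show ?thesis using E' by (simp add: c_def)
      qed
      have "(\<Sum>e\<in>E. c e * a g e) = 0" if "g \<in> insert f F" for g
      proof (cases "g = f")
        case True
        then show ?thesis using e0 by (simp add: cs s_def)
      next
        case False
        then have "0 = (\<Sum>e\<in>E'. c' e * a' g e)" using that c'(2) by auto
        also have "\<dots> = (\<Sum>e\<in>E'. c' e * a g e) - s * a g e0"
          by (simp add: a'_def s_def sum_subtractf algebra_simps sum_divide_distrib sum_distrib_left)
        finally show ?thesis by (simp add: cs)
      qed
      moreover have "\<exists>e\<in>E. c e \<noteq> 0"
        using c'(1) E' by (auto simp: c_def)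
      ultimately show ?thesis by blast
    qed
  qed
  then show thesis using that by blast
qed

section \<open>Semi-inner products and orthonormal systems\<close>

locale semi_inner =
  fixes ip :: "'v::real_vector \<Rightarrow> 'v \<Rightarrow> real"
  assumes ip_add: "ip (x + y) z = ip x z + ip y z"
    and ip_scale: "ip (c *\<^sub>R x) z = c * ip x z"
    and ip_sym: "ip x y = ip y x"
    and ip_nonneg: "ip x x \<ge> 0"
begin

lemma ip_add2: "ip z (x + y) = ip z x + ip z y"
  by (metis ip_add ip_sym)

lemma ip_scale2: "ip z (c *\<^sub>R x) = c * ip z x"
  by (metis ip_scale ip_sym)

lemma ip_zero [simp]: "ip 0 z = 0" "ip z 0 = 0"
  using ip_scale[of 0 0 z] ip_scale2[of z 0 0] by auto

lemma ip_minus: "ip (x - y) z = ip x z - ip y z"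
  using ip_add[of "x - y" y z] by simp

lemma ip_minus2: "ip z (x - y) = ip z x - ip z y"
  by (metis ip_minus ip_sym)

lemma ip_sum: "ip (\<Sum>i\<in>I. f i) z = (\<Sum>i\<in>I. ip (f i) z)"
  by (induction I rule: infinite_finite_induct) (auto simp: ip_add)

lemma ip_sum2: "ip z (\<Sum>i\<in>I. f i) = (\<Sum>i\<in>I. ip z (f i))"
  by (simp add: ip_sum ip_sym[of z])

text \<open>Replaces definiteness, since nonzero vectors may have length 0. If \<open>ip x y\<close>
  were nonzero, the squared length of \<open>t *\<^sub>R x + y\<close> would be a nonconstant affine
  function of \<open>t\<close> and so negative somewhere; the \<open>t\<close> below gives the value
  -1.\<close>

lemma ip_null:
  assumes "ip x x = 0"
  shows "ip x y = 0"
proof (rule ccontr)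
  assume ne: "ip x y \<noteq> 0"
  define t where "t = - (ip y y + 1) / (2 * ip x y)"
  have "0 \<le> ip (t *\<^sub>R x + y) (t *\<^sub>R x + y)" by (rule ip_nonneg)
  also have "\<dots> = 2 * t * ip x y + ip y y"
    using assms by (simp add: ip_add ip_add2 ip_scale ip_scale2 ip_sym[of y x])
  also have "\<dots> = - 1" using ne by (simp add: t_def field_simps)
  finally show False by simp
qed

definition orthonormal :: "'v set \<Rightarrow> bool" where
  "orthonormal H \<longleftrightarrow> (\<forall>x\<in>H. \<forall>y\<in>H. ip x y = (if x = y then 1 else 0))"

lemma ip_orthonormal_sum:
  assumes "orthonormal H" "finite H" "h' \<in> H"
  shows "ip (\<Sum>h\<in>H. c h *\<^sub>R h) h' = c h'"
proof -
  have "ip (\<Sum>h\<in>H. c h *\<^sub>R h) h' = (\<Sum>h\<in>H. if h = h' then c h else 0)"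
    unfolding ip_sum using assms by (intro sum.cong) (auto simp: ip_scale orthonormal_def)
  then show ?thesis using assms by simp
qed

text \<open>Bessel's inequality: \<open>s\<close> is the projection of \<open>x\<close>, and
  \<open>x - s\<close> has nonnegative squared length.\<close>

lemma bessel:
  assumes "finite I" "\<And>p q. p \<in> I \<Longrightarrow> q \<in> I \<Longrightarrow> ip (e p) (e q) = (if p = q then 1 else 0)"
  shows "(\<Sum>p\<in>I. (ip x (e p))\<^sup>2) \<le> ip x x"
proof -
  define s where "s = (\<Sum>p\<in>I. ip x (e p) *\<^sub>R e p)"
  have xs: "ip x s = (\<Sum>p\<in>I. (ip x (e p))\<^sup>2)"
    by (simp add: s_def ip_sum2 ip_scale2 power2_eq_square)
  have se: "ip s (e q) = ip x (e q)" if "q \<in> I" for q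
  proof -
    have "ip s (e q) = (\<Sum>p\<in>I. if p = q then ip x (e p) else 0)"
      unfolding s_def ip_sum using assms that by (intro sum.cong) (auto simp: ip_scale)
    then show ?thesis using assms that by simp
  qed
  have "ip s s = (\<Sum>p\<in>I. ip x (e p) * ip s (e p))"
    by (subst (2) s_def) (simp add: ip_sum2 ip_scale2)
  also have "\<dots> = (\<Sum>p\<in>I. (ip x (e p))\<^sup>2)"
    by (intro sum.cong) (auto simp: se power2_eq_square)
  finally have "ip s s = ip x s" using xs by simp
  then have "ip (x - s) (x - s) = ip x x - ip x s"
    by (simp add: ip_minus ip_minus2 ip_sym[of s x])
  with ip_nonneg[of "x - s"] xs show ?thesis by simp
qed

text \<open>Gram-Schmidt; vectors are recovered only up to vectors of length 0.\<close>
lemma gram_schmidt: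
  assumes "finite B"
  obtains H where "finite H" "card H \<le> card B" "orthonormal H"
    "\<And>b. b \<in> span B \<Longrightarrow> \<exists>c. \<forall>z. ip b z = ip (\<Sum>h\<in>H. c h *\<^sub>R h) z"
proof -
  have "\<exists>H. finite H \<and> card H \<le> card B \<and> orthonormal H \<and>
    (\<forall>b\<in>B. \<exists>c. \<forall>z. ip b z = ip (\<Sum>h\<in>H. c h *\<^sub>R h) z)"
    using assms
  proof (induction B rule: finite_induct)
    case empty
    then show ?case by (intro exI[of _ "{}"]) (auto simp: orthonormal_def)
  next
    case (insert b B)
    then obtain H where H: "finite H" "card H \<le> card B" "orthonormal H"
      "\<And>b. b \<in> B \<Longrightarrow> \<exists>c. \<forall>z. ip b z = ip (\<Sum>h\<in>H. c h *\<^sub>R h) z" by blast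
    define s where "s = (\<Sum>h\<in>H. ip b h *\<^sub>R h)"
    define r where "r = b - s"
    have r0: "ip r h = 0" if "h \<in> H" for h
      using ip_orthonormal_sum[OF H(3,1) that, of "ip b"] by (simp add: r_def ip_minus s_def)
    show ?case
    proof (cases "ip r r = 0")
      \<comment> \<open>A residual of length 0 is invisible to \<open>ip\<close>, so
        \<open>H\<close> does not grow.\<close>
      case True
      then have "ip b z = ip s z" for z
        using ip_null[OF True, of z] by (simp add: r_def ip_minus)
      then have "\<forall>b'\<in>insert b B. \<exists>c. \<forall>z. ip b' z = ip (\<Sum>h\<in>H. c h *\<^sub>R h) z"
        using H(4) unfolding s_def by blast
      then show ?thesis using H insert.hyps by (intro exI[of _ H]) auto
    next
      case False
      then have rpos: "ip r r > 0" using ip_nonneg[of r] by simp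
      define u where "u = (1 / sqrt (ip r r)) *\<^sub>R r"
      have uu: "ip u u = 1" using rpos by (simp add: u_def ip_scale ip_scale2)
      have uo: "ip u h = 0" "ip h u = 0" if "h \<in> H" for h
        using r0[OF that] by (auto simp: u_def ip_scale ip_scale2 ip_sym[of h])
      have unot: "u \<notin> H" using uu uo by force
      have on: "orthonormal (insert u H)"
        using H(3) uu uo by (auto simp: orthonormal_def)
      have ext: "\<exists>c. \<forall>z. ip b' z = ip (\<Sum>h\<in>insert u H. c h *\<^sub>R h) z" if b': "b' \<in> insert b B" for b'
      proof (cases "b' = b")
        case True
        have "(\<Sum>h\<in>H. (if h = u then sqrt (ip r r) else ip b h) *\<^sub>R h) = s"
          unfolding s_def using unot by (intro sum.cong) auto
        then have "(\<Sum>h\<in>insert u H. (if h = u then sqrt (ip r r) else ip b h) *\<^sub>R h) = b"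
          using H(1) unot rpos by (simp add: u_def r_def)
        then show ?thesis using True by metis
      next
        case False
        then obtain c where c: "\<forall>z. ip b' z = ip (\<Sum>h\<in>H. c h *\<^sub>R h) z"
          using H(4)[of b'] b' by blast
        have "(\<Sum>h\<in>H. (if h = u then 0 else c h) *\<^sub>R h) = (\<Sum>h\<in>H. c h *\<^sub>R h)"
          using unot by (intro sum.cong) auto
        then have "(\<Sum>h\<in>insert u H. (if h = u then 0 else c h) *\<^sub>R h) = (\<Sum>h\<in>H. c h *\<^sub>R h)"
          using H(1) unot by simp
        then show ?thesis using c by metis
      qed
      show ?thesis
        using H insert.hyps unot on ext by (intro exI[of _ "insert u H"]) auto
    qed
  qed
  then obtain H where H: "finite H" "card H \<le> card B" "orthonormal H"
      "\<And>b. b \<in> B \<Longrightarrow> \<exists>c. \<forall>z. ip b z = ip (\<Sum>h\<in>H. c h *\<^sub>R h) z" by blast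
  have "\<exists>c. \<forall>z. ip b z = ip (\<Sum>h\<in>H. c h *\<^sub>R h) z" if "b \<in> span B" for b
    using that
  proof (induction rule: span_induct_alt)
    case base
    show ?case by (rule exI[of _ "\<lambda>_. 0"]) simp
  next
    case (step k x y)
    then obtain c d where c: "\<forall>z. ip x z = ip (\<Sum>h\<in>H. c h *\<^sub>R h) z"
      and d: "\<forall>z. ip y z = ip (\<Sum>h\<in>H. d h *\<^sub>R h) z" using H(4) by meson
    have "ip (k *\<^sub>R x + y) z = ip (\<Sum>h\<in>H. (k * c h + d h) *\<^sub>R h) z" for z
    proof -
      have "(\<Sum>h\<in>H. (k * c h + d h) *\<^sub>R h) = k *\<^sub>R (\<Sum>h\<in>H. c h *\<^sub>R h) + (\<Sum>h\<in>H. d h *\<^sub>R h)"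
        by (simp add: scaleR_add_left sum.distrib scaleR_sum_right)
      then show ?thesis using c d by (simp add: ip_add ip_scale)
    qed
    then show ?case by (intro exI[of _ "\<lambda>h. k * c h + d h"]) simp
  qed
  then show thesis using H that by blast
qed

text \<open>Count \<open>(ip (e p) h)\<^sup>2\<close> over all \<open>p\<close> and \<open>h\<close>
  in two ways, with \<open>H\<close> an orthonormal system for \<open>B\<close>. Closeness to the
  span gives every \<open>e p\<close> at least \<open>1 - \<epsilon>\<close>; Bessel's inequality
  for the family \<open>e\<close> gives every \<open>h\<close> at most 1.\<close>

lemma orthonormal_near_span:
  fixes e :: "'i \<Rightarrow> 'v" and \<epsilon> :: real
  assumes I: "finite I" "\<And>p q. p \<in> I \<Longrightarrow> q \<in> I \<Longrightarrow> ip (e p) (e q) = (if p = q then 1 else 0)"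
    and B: "finite B"
    and near: "\<And>p. p \<in> I \<Longrightarrow> \<exists>v\<in>span B. ip (e p - v) (e p - v) \<le> \<epsilon>"
  shows "card I * (1 - \<epsilon>) \<le> card B"
proof -
  obtain H where H: "finite H" "card H \<le> card B" "orthonormal H"
    "\<And>b. b \<in> span B \<Longrightarrow> \<exists>c. \<forall>z. ip b z = ip (\<Sum>h\<in>H. c h *\<^sub>R h) z"
    using gram_schmidt[OF B] by metis
  have "1 - \<epsilon> \<le> (\<Sum>h\<in>H. (ip (e p) h)\<^sup>2)" if p: "p \<in> I" for p
  proof -
    obtain v where v: "v \<in> span B" "ip (e p - v) (e p - v) \<le> \<epsilon>" using near[OF p] by blast
    obtain c where c: "\<And>z. ip v z = ip (\<Sum>h\<in>H. c h *\<^sub>R h) z" using H(4)[OF v(1)] by blast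
    define w where "w = (\<Sum>h\<in>H. c h *\<^sub>R h)"
    have vw: "ip v z = ip w z" "ip z v = ip z w" for z using c ip_sym w_def by metis+
    have ww: "ip w w = (\<Sum>h\<in>H. (c h)\<^sup>2)"
    proof -
      have "ip w w = (\<Sum>h\<in>H. c h * ip w h)" by (subst (2) w_def) (simp add: ip_sum2 ip_scale2)
      also have "\<dots> = (\<Sum>h\<in>H. (c h)\<^sup>2)"
        by (intro sum.cong) (auto simp: w_def ip_orthonormal_sum[OF H(3,1)] power2_eq_square)
      finally show ?thesis .
    qed
    have ew: "ip (e p) w = (\<Sum>h\<in>H. c h * ip (e p) h)" by (simp add: w_def ip_sum2 ip_scale2)
    have "ip (e p - v) (e p - v) = 1 - 2 * ip (e p) w + ip w w"
      using I(2)[OF p p] by (simp add: ip_minus ip_minus2 vw ip_sym[of w "e p"])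
    also have "\<dots> = 1 + (\<Sum>h\<in>H. (c h)\<^sup>2 - 2 * (c h * ip (e p) h))"
      by (simp add: ww ew sum_subtractf sum_distrib_left)
    \<comment> \<open>Completing the square coefficient by coefficient, since \<open>v\<close> need
      not be the best approximation of \<open>e p\<close>.\<close>
    also have "\<dots> \<ge> 1 + (\<Sum>h\<in>H. - (ip (e p) h)\<^sup>2)"
    proof -
      have "- y\<^sup>2 \<le> x\<^sup>2 - 2 * (x * y)" for x y :: real
        using zero_le_power2[of "x - y"] by (simp add: power2_diff)
      then show ?thesis by (intro add_left_mono sum_mono) auto
    qed
    finally show ?thesis using v(2) by (simp add: sum_negf)
  qed
  then have "card I * (1 - \<epsilon>) \<le> (\<Sum>p\<in>I. \<Sum>h\<in>H. (ip (e p) h)\<^sup>2)"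
    using sum_mono[of I "\<lambda>_. 1 - \<epsilon>" "\<lambda>p. \<Sum>h\<in>H. (ip (e p) h)\<^sup>2"] by simp
  also have "\<dots> = (\<Sum>h\<in>H. \<Sum>p\<in>I. (ip h (e p))\<^sup>2)"
    by (subst sum.swap) (simp add: ip_sym)
  also have "\<dots> \<le> (\<Sum>h\<in>H. ip h h)" by (intro sum_mono bessel I)
  also have "\<dots> = card H" using H(3) by (simp add: orthonormal_def)
  finally show ?thesis using H(2) by linarith
qed

end

section \<open>Ergodic measures\<close>

lemma int_iterate_Suc:
  assumes "bij T"
  shows "int_iterate T (n + 1) = T \<circ> int_iterate T n"
proof (cases "n \<ge> 0")
  case True
  then show ?thesis by (simp add: int_iterate_def nat_add_distrib)
next
  case False
  then obtain k where k: "n = - int (Suc k)"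
    by (metis linorder_not_le neg_int_cases not0_implies_Suc of_nat_0_less_iff less_irrefl)
  have "T \<circ> inv T = id" using assms by (metis bij_is_surj surj_iff)
  then have "T \<circ> int_iterate T n = inv T ^^ k"
    by (simp add: int_iterate_def k nat_add_distrib flip: comp_assoc)
  also have "\<dots> = int_iterate T (- int k)"
    by (cases k) (auto simp: int_iterate_def simp del: of_nat_Suc)
  also have "- int k = n + 1" by (simp add: k)
  finally show ?thesis by (rule sym)
qed

lemma int_iterate_0 [simp]: "int_iterate T 0 = id"
  by (simp add: int_iterate_def id_def)

lemma int_iterate_of_nat [simp]: "int_iterate T (int n) = T ^^ n"
  by (simp add: int_iterate_def)

lemma int_iterate_add:
  assumes "bij T"
  shows "int_iterate T (m + n) = int_iterate T m \<circ> int_iterate T n"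
proof (induction m rule: int_induct[of _ 0])
  case base
  show ?case by simp
next
  case (step1 i)
  have "int_iterate T (i + 1 + n) = int_iterate T ((i + n) + 1)" by (simp add: ac_simps)
  also have "\<dots> = T \<circ> int_iterate T (i + n)" by (rule int_iterate_Suc[OF assms])
  finally show ?case
    by (simp add: step1 int_iterate_Suc[OF assms] comp_assoc)
next
  case (step2 i)
  \<comment> \<open>The downward step is proved after composing with \<open>T\<close>, which is then
    cancelled by injectivity.\<close>
  have "T \<circ> int_iterate T (i - 1 + n) = int_iterate T (i + n)"
    using int_iterate_Suc[OF assms, of "i - 1 + n"] by (simp add: algebra_simps)
  also have "\<dots> = T \<circ> (int_iterate T (i - 1) \<circ> int_iterate T n)"
    using int_iterate_Suc[OF assms, of "i - 1"] step2(2) by (metis comp_assoc diff_add_cancel)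
  finally show ?case
    using bij_is_inj[OF assms] by (metis injD o_apply ext)
qed

locale homeomorphism_system =
  fixes T :: "'a::topological_space \<Rightarrow> 'a"
  assumes homeo: "homeomorphic_map euclidean euclidean T"
begin

lemma bij_T: "bij T"
  using homeo by (auto simp: homeomorphic_eq_everything_map bij_def)

lemma continuous_T: "continuous_on UNIV T"
  using homeo by (simp add: homeomorphic_eq_everything_map)

lemma continuous_inv_T: "continuous_on UNIV (inv T)"
proof -
  have "open (inv T -` U)" if "open U" for U
  proof -
    have "open (T ` U)"
      using homeo that by (simp add: homeomorphic_eq_everything_map open_map_def)
    moreover have "inv T -` U = T ` U"
      using bij_T by (metis bij_imp_bij_inv bij_vimage_eq_inv_image inv_inv_eq)
    ultimately show ?thesis by simp
  qed
  then show ?thesis by (simp add: continuous_on_open_vimage)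
qed

lemma continuous_funpow:
  assumes "continuous_on UNIV (f :: 'a \<Rightarrow> 'a)"
  shows "continuous_on UNIV (f ^^ n)"
proof (induction n)
  case (Suc n)
  then show ?case
    unfolding funpow.simps using assms by (metis continuous_on_compose continuous_on_subset top_greatest)
qed (simp add: id_def)

lemma continuous_int_iterate: "continuous_on UNIV (int_iterate T n)"
  by (simp add: int_iterate_def continuous_funpow continuous_T continuous_inv_T)

text \<open>Names the function that \<open>translates\<close> describes only through its underlying
  map; the next lemma checks that the argument of \<open>Bcontfun\<close> is bounded and
  continuous.\<close>

definition translate :: "int \<Rightarrow> ('a \<Rightarrow>\<^sub>C real) \<Rightarrow> ('a \<Rightarrow>\<^sub>C real)" where
  "translate n f = Bcontfun (apply_bcontfun f \<circ> int_iterate T n)"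

lemma apply_translate [simp]: "apply_bcontfun (translate n f) x = f (int_iterate T n x)"
proof -
  have "continuous_on UNIV (apply_bcontfun f \<circ> int_iterate T n)"
    by (intro continuous_on_compose continuous_int_iterate) simp
  moreover have "norm ((apply_bcontfun f \<circ> int_iterate T n) x) \<le> norm f" for x
    by (simp add: norm_bounded del: real_norm_def)
  ultimately have "apply_bcontfun f \<circ> int_iterate T n \<in> bcontfun"
    by (intro bcontfun_normI)
  then show ?thesis by (simp add: translate_def Bcontfun_inverse)
qed

lemma translates_eq: "translates T F = {translate n f | n f. f \<in> F}"
proof -
  have "apply_bcontfun g = apply_bcontfun f \<circ> int_iterate T n \<longleftrightarrow> g = translate n f" for g f n
  proof
    assume "apply_bcontfun g = apply_bcontfun f \<circ> int_iterate T n"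
    then show "g = translate n f" by (intro bcontfun_eqI) simp
  qed (auto simp: fun_eq_iff)
  then show ?thesis unfolding translates_def by blast
qed

lemma linear_translate: "linear (translate n)"
  by (intro linearI bcontfun_eqI) auto

lemma translate_translate: "translate m (translate n f) = translate (m + n) f"
  by (intro bcontfun_eqI) (simp add: int_iterate_add[OF bij_T] add.commute[of m])

end

section \<open>Continuous functions and Borel probability measures\<close>

lemma integrable_bcontfun:
  fixes f :: "'a::topological_space \<Rightarrow>\<^sub>C real"
  assumes "sets \<mu> = sets borel" "prob_space \<mu>"
  shows "integrable \<mu> f"
proof -
  interpret prob_space \<mu> by fact
  have "apply_bcontfun f \<in> borel_measurable \<mu>"
    using borel_measurable_continuous_onI[of f] assms(1) by (simp cong: measurable_cong_sets)
  then show ?thesis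
    using norm_bounded[of f] by (intro integrable_const_bound[of _ "norm f"]) auto
qed

lemma bounded_linear_integral_bcontfun:
  assumes "sets \<mu> = sets borel" "prob_space \<mu>"
  shows "bounded_linear (\<lambda>f::'a::topological_space \<Rightarrow>\<^sub>C real. \<integral>x. f x \<partial>\<mu>)"
proof (rule bounded_linear_intro[where K = 1])
  interpret prob_space \<mu> by fact
  note int = integrable_bcontfun[OF assms]
  show "(\<integral>x. (f + g) x \<partial>\<mu>) = (\<integral>x. f x \<partial>\<mu>) + (\<integral>x. g x \<partial>\<mu>)" for f g :: "'a \<Rightarrow>\<^sub>C real"
    using int by simp
  show "(\<integral>x. (r *\<^sub>R f) x \<partial>\<mu>) = r *\<^sub>R (\<integral>x. f x \<partial>\<mu>)" for r and f :: "'a \<Rightarrow>\<^sub>C real"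
    by simp
  show "norm (\<integral>x. f x \<partial>\<mu>) \<le> norm f * 1" for f :: "'a \<Rightarrow>\<^sub>C real"
  proof -
    have "norm (\<integral>x. f x \<partial>\<mu>) \<le> (\<integral>x. norm (f x) \<partial>\<mu>)" by (rule integral_norm_bound)
    also have "\<dots> \<le> (\<integral>x. norm f \<partial>\<mu>)"
      using int[of f] by (intro integral_mono) (auto simp: norm_bounded simp del: real_norm_def)
    finally show ?thesis by (simp add: prob_space)
  qed
qed

text \<open>In a metrizable space \<open>K\<close> is the intersection of a decreasing sequence of
  open sets \<open>U n\<close>; take Urysohn functions that are 1 on \<open>K\<close> and 0 outside
  \<open>U n\<close>.\<close>

lemma closed_indicator_limit:
  fixes K :: "'a::topological_space set"
  assumes "metrizable_space (euclidean :: 'a topology)" "closed K"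
  obtains \<phi> :: "nat \<Rightarrow> 'a \<Rightarrow>\<^sub>C real" where
    "\<And>n x. \<bar>\<phi> n x\<bar> \<le> 1" "\<And>x. (\<lambda>n. \<phi> n x) \<longlonglongrightarrow> indicator K x"
proof -
  have "gdelta_in euclidean K"
    using closed_imp_gdelta_in[OF assms(1)] assms(2) by simp
  then obtain U where U: "\<And>n. open (U n)" "\<And>n. U (Suc n) \<subseteq> U n" "\<Inter> (range U) = K"
    unfolding gdelta_in_descending by auto
  have "\<exists>f::'a \<Rightarrow>\<^sub>C real. (\<forall>x. \<bar>f x\<bar> \<le> 1) \<and> (\<forall>x\<in>K. f x = 1) \<and> (\<forall>x. x \<notin> U n \<longrightarrow> f x = 0)" for n
  proof -
    obtain f :: "'a \<Rightarrow> real" where f: "continuous_map euclidean (top_of_set {0..1}) f"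
      "f ` (- U n) \<subseteq> {0}" "f ` K \<subseteq> {1}"
    proof (rule Urysohn_lemma[of "euclidean :: 'a topology" "- U n" K 0 1])
      show "normal_space (euclidean :: 'a topology)" by (rule metrizable_imp_normal_space[OF assms(1)])
    qed (use U assms(2) in \<open>auto simp: disjnt_def\<close>)
    have cont: "continuous_on UNIV f" and bd: "\<And>x. f x \<in> {0..1}"
      using f(1) by (auto simp: continuous_map_in_subtopology)
    have "f \<in> bcontfun"
      using bd by (intro bcontfun_normI[OF cont, of 1]) auto
    then obtain g where g: "f = apply_bcontfun g" by (rule bcontfunE)
    then show ?thesis using bd f(2,3) by (intro exI[of _ g]) (auto simp: image_subset_iff)
  qed
  then obtain \<phi> :: "nat \<Rightarrow> 'a \<Rightarrow>\<^sub>C real" where \<phi>: "\<And>n x. \<bar>\<phi> n x\<bar> \<le> 1"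
    "\<And>n x. x \<in> K \<Longrightarrow> \<phi> n x = 1" "\<And>n x. x \<notin> U n \<Longrightarrow> \<phi> n x = 0"
    by metis
  have "(\<lambda>n. \<phi> n x) \<longlonglongrightarrow> indicator K x" for x
  proof (cases "x \<in> K")
    case False
    then obtain m where m: "x \<notin> U m" using U(3) by auto
    have "x \<notin> U n" if "n \<ge> m" for n
      using m lift_Suc_antimono_le[of U, OF U(2) that] by auto
    then have "eventually (\<lambda>n. \<phi> n x = indicator K x) sequentially"
      using False \<phi>(3) by (intro eventually_sequentiallyI[of m]) auto
    then show ?thesis by (rule tendsto_eventually)
  qed (simp add: \<phi>(2))
  then show thesis using \<phi>(1) that by blast
qed

text \<open>A signed measure that annihilates C(X) is zero: dominated convergence handles closed
  sets, and a Dynkin system argument extends this to all Borel sets.\<close>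

lemma signed_measure_eq_0:
  fixes E :: "'a::topological_space measure set"
  assumes metr: "metrizable_space (euclidean :: 'a topology)"
    and E: "\<And>\<mu>. \<mu> \<in> E \<Longrightarrow> sets \<mu> = sets borel" "\<And>\<mu>. \<mu> \<in> E \<Longrightarrow> prob_space \<mu>"
    and zero: "\<And>f :: 'a \<Rightarrow>\<^sub>C real. (\<Sum>\<mu>\<in>E. c \<mu> * (\<integral>x. f x \<partial>\<mu>)) = 0"
    and A: "A \<in> sets borel"
  shows "(\<Sum>\<mu>\<in>E. c \<mu> * measure \<mu> A) = 0"
proof -
  have sp: "space \<mu> = UNIV" if "\<mu> \<in> E" for \<mu>
    using sets_eq_imp_space_eq[OF E(1)[OF that]] by simp
  \<comment> \<open>The total mass, obtained from the constant function 1; it gives closure under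
    complements.\<close>
  have tot: "(\<Sum>\<mu>\<in>E. c \<mu>) = 0"
  proof -
    have "(\<Sum>\<mu>\<in>E. c \<mu> * (\<integral>x. (const_bcontfun 1 :: 'a \<Rightarrow>\<^sub>C real) x \<partial>\<mu>)) = (\<Sum>\<mu>\<in>E. c \<mu>)"
      by (intro sum.cong) (auto simp: prob_space.prob_space E)
    then show ?thesis using zero[of "const_bcontfun 1"] by simp
  qed
  have closed: "(\<Sum>\<mu>\<in>E. c \<mu> * measure \<mu> K) = 0" if K: "closed K" for K
  proof -
    obtain \<phi> :: "nat \<Rightarrow> 'a \<Rightarrow>\<^sub>C real" where \<phi>: "\<And>n x. \<bar>\<phi> n x\<bar> \<le> 1"
      "\<And>x. (\<lambda>n. \<phi> n x) \<longlonglongrightarrow> indicator K x"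
      by (rule closed_indicator_limit[OF metr K]) blast
    have "(\<lambda>n. \<integral>x. \<phi> n x \<partial>\<mu>) \<longlonglongrightarrow> measure \<mu> K" if "\<mu> \<in> E" for \<mu>
    proof -
      interpret prob_space \<mu> using E that by blast
      have "K \<in> sets \<mu>" using E(1)[OF that] K by simp
      have "(\<lambda>n. \<integral>x. \<phi> n x \<partial>\<mu>) \<longlonglongrightarrow> (\<integral>x. indicator K x \<partial>\<mu>)"
      proof (rule integral_dominated_convergence[where w = "\<lambda>_. 1"])
        show "apply_bcontfun (\<phi> n) \<in> borel_measurable \<mu>" for n
          using integrable_bcontfun[OF E(1)[OF that] E(2)[OF that], of "\<phi> n"] by simp
      qed (use \<phi> \<open>K \<in> sets \<mu>\<close> in auto)
      then show ?thesis using \<open>K \<in> sets \<mu>\<close> by (simp add: sp[OF that])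
    qed
    then have "(\<lambda>n. \<Sum>\<mu>\<in>E. c \<mu> * (\<integral>x. \<phi> n x \<partial>\<mu>)) \<longlonglongrightarrow> (\<Sum>\<mu>\<in>E. c \<mu> * measure \<mu> K)"
      by (intro tendsto_sum tendsto_mult_left) auto
    then show ?thesis using zero by (simp add: LIMSEQ_const_iff)
  qed
  have compl: "(\<Sum>\<mu>\<in>E. c \<mu> * measure \<mu> (UNIV - B)) = 0"
    if "B \<in> sets borel" "(\<Sum>\<mu>\<in>E. c \<mu> * measure \<mu> B) = 0" for B
  proof -
    have "(\<Sum>\<mu>\<in>E. c \<mu> * measure \<mu> (UNIV - B)) = (\<Sum>\<mu>\<in>E. c \<mu> - c \<mu> * measure \<mu> B)"
    proof (intro sum.cong refl)
      fix \<mu> assume "\<mu> \<in> E"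
      then interpret prob_space \<mu> using E by blast
      show "c \<mu> * measure \<mu> (UNIV - B) = c \<mu> - c \<mu> * measure \<mu> B"
        using prob_compl[of B] that(1) E(1)[OF \<open>\<mu> \<in> E\<close>] sp[OF \<open>\<mu> \<in> E\<close>]
        by (simp add: right_diff_distrib)
    qed
    then show ?thesis using tot that(2) by (simp add: sum_subtractf)
  qed
  have "Int_stable {S :: 'a set. open S}" by (auto simp: Int_stable_def)
  moreover have "{S :: 'a set. open S} \<subseteq> Pow UNIV" by simp
  moreover have "A \<in> sigma_sets UNIV {S :: 'a set. open S}"
    using A by (simp add: sets_borel)
  ultimately show ?thesis
  proof (induction rule: sigma_sets_induct_disjoint)
    case (basic B)
    then have "(\<Sum>\<mu>\<in>E. c \<mu> * measure \<mu> (UNIV - (UNIV - B))) = 0"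
      by (intro compl closed) auto
    then show ?case by (simp add: Diff_Diff_Int)
  next
    case (union B)
    have B: "range B \<subseteq> sets borel" using union(2) by (simp add: sets_borel)
    have "(\<lambda>i. measure \<mu> (B i)) sums measure \<mu> (\<Union>i. B i)" if "\<mu> \<in> E" for \<mu>
    proof -
      interpret prob_space \<mu> using E that by blast
      show ?thesis using B union(1) E(1)[OF that] by (intro finite_measure_UNION) auto
    qed
    then have "(\<lambda>i. \<Sum>\<mu>\<in>E. c \<mu> * measure \<mu> (B i)) sums (\<Sum>\<mu>\<in>E. c \<mu> * measure \<mu> (\<Union>i. B i))"
      by (intro sums_sum sums_mult) auto
    then show ?case using union(3) by (simp add: sums_0 sums_unique2[of "\<lambda>_. 0"])
  qed (use compl in \<open>auto simp: sets_borel\<close>)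
qed

text \<open>Both total masses are 1, so the inequality for the complement is the reverse inequality
  for the set.\<close>

lemma prob_measure_le_imp_eq:
  assumes "sets \<mu> = sets \<nu>" "prob_space \<mu>" "prob_space \<nu>"
    and le: "\<And>A. A \<in> sets \<mu> \<Longrightarrow> emeasure \<nu> A \<le> emeasure \<mu> A"
  shows "\<mu> = \<nu>"
proof (rule measure_eqI)
  interpret M: prob_space \<mu> by fact
  interpret N: prob_space \<nu> by fact
  have sp: "space \<nu> = space \<mu>" using sets_eq_imp_space_eq[OF assms(1)] by simp
  fix A assume A: "A \<in> sets \<mu>"
  have "measure \<nu> (space \<mu> - A) \<le> measure \<mu> (space \<mu> - A)"
    using le[of "space \<mu> - A"] A by (simp add: M.emeasure_eq_measure N.emeasure_eq_measure)
  then have "measure \<mu> A \<le> measure \<nu> A"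
    using M.prob_compl[OF A] N.prob_compl[of A] A assms(1) sp by simp
  moreover have "measure \<nu> A \<le> measure \<mu> A"
    using le[OF A] by (simp add: M.emeasure_eq_measure N.emeasure_eq_measure)
  ultimately show "emeasure \<mu> A = emeasure \<nu> A"
    by (simp add: M.emeasure_eq_measure N.emeasure_eq_measure)
qed (fact assms(1))

section \<open>Invariant measures, and separation of ergodic ones\<close>

context homeomorphism_system
begin

lemma vimage_int_iterate_borel: "A \<in> sets borel \<Longrightarrow> int_iterate T n -` A \<in> sets borel"
  using borel_measurable_continuous_onI[OF continuous_int_iterate[of n]]
  by (metis measurable_sets_borel)

lemma invariant_int_iterate:
  assumes "invariant_borel_prob T \<mu>" "A \<in> sets borel"
  shows "emeasure \<mu> (int_iterate T n -` A) = emeasure \<mu> A"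
  using assms(2)
proof (induction n arbitrary: A rule: int_induct[of _ 0])
  case base
  then show ?case by simp
next
  case (step1 i)
  have "int_iterate T (i + 1) -` A = int_iterate T i -` (T -` A)"
    by (auto simp: int_iterate_Suc[OF bij_T])
  moreover have "T -` A \<in> sets borel"
    using vimage_int_iterate_borel[OF step1(3), of 1] int_iterate_of_nat[of T 1] by simp
  ultimately show ?case
    using step1 assms(1) by (simp add: invariant_borel_prob_def)
next
  case (step2 i)
  \<comment> \<open>Invariance is only assumed for preimages under \<open>T\<close>. Here
    \<open>B\<close> is the image of \<open>A\<close> under \<open>T\<close>, so that
    \<open>A\<close> is the preimage of \<open>B\<close>.\<close>
  define B where "B = int_iterate T (- 1) -` A"
  have B: "B \<in> sets borel" using vimage_int_iterate_borel step2 by (simp add: B_def)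
  have "int_iterate T (i - 1) -` A = int_iterate T i -` B"
    using int_iterate_add[OF bij_T, of "- 1" i] by (simp add: B_def vimage_comp)
  moreover have "T -` B = A"
    using int_iterate_add[OF bij_T, of "- 1" 1] int_iterate_of_nat[of T 1]
    by (simp add: B_def vimage_comp)
  then have "emeasure \<mu> B = emeasure \<mu> A"
    using assms(1) B by (auto simp: invariant_borel_prob_def)
  ultimately show ?case using step2(2)[OF B] by simp
qed

text \<open>Change of variables, as the iterate maps \<open>\<mu>\<close> to itself.\<close>

lemma integral_translate:
  assumes "invariant_borel_prob T \<mu>"
  shows "(\<integral>x. translate n f x \<partial>\<mu>) = (\<integral>x. f x \<partial>\<mu>)"
proof -
  have sets: "sets \<mu> = sets borel" using assms by (simp add: invariant_borel_prob_def)
  have sp: "space \<mu> = UNIV" using sets_eq_imp_space_eq[OF sets] by simp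
  have meas: "int_iterate T n \<in> measurable \<mu> \<mu>"
    using borel_measurable_continuous_onI[OF continuous_int_iterate[of n]] sets
    by (simp cong: measurable_cong_sets)
  have "distr \<mu> \<mu> (int_iterate T n) = \<mu>"
    using invariant_int_iterate[OF assms] meas sets sp
    by (intro measure_eqI) (auto simp: emeasure_distr)
  moreover have "apply_bcontfun f \<in> borel_measurable \<mu>"
    using borel_measurable_continuous_onI[of f] sets by (simp cong: measurable_cong_sets)
  ultimately have "(\<integral>x. f x \<partial>\<mu>) = (\<integral>x. f (int_iterate T n x) \<partial>\<mu>)"
    by (metis integral_distr meas)
  then show ?thesis by simp
qed

text \<open>A Hahn set of the difference of the two measures stays one when it is made invariant by
  taking the union of all its translates; ergodicity then forces its measures to be 1 and 0.\<close>
lemma ergodic_separated: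
  assumes "ergodic_borel_prob T \<mu>" "ergodic_borel_prob T \<nu>" "\<mu> \<noteq> \<nu>"
  obtains B where "B \<in> sets borel" "emeasure \<mu> B = 1" "emeasure \<nu> B = 0"
proof -
  have inv: "invariant_borel_prob T \<mu>" "invariant_borel_prob T \<nu>"
    using assms by (auto simp: ergodic_borel_prob_def)
  then have sets: "sets \<mu> = sets borel" "sets \<nu> = sets borel"
    and pr: "prob_space \<mu>" "prob_space \<nu>"
    by (auto simp: invariant_borel_prob_def)
  interpret M: prob_space \<mu> by fact
  interpret N: prob_space \<nu> by fact
  obtain Y where Y: "Y \<in> sets borel"
    "\<And>X. X \<in> sets borel \<Longrightarrow> X \<subseteq> Y \<Longrightarrow> emeasure \<nu> X \<le> emeasure \<mu> X"
    "\<And>X. X \<in> sets borel \<Longrightarrow> X \<inter> Y = {} \<Longrightarrow> emeasure \<mu> X \<le> emeasure \<nu> X"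
    using finite_unsigned_Hahn_decomposition[OF M.finite_measure_axioms N.finite_measure_axioms] sets
    by auto
  \<comment> \<open>The integers are enumerated by naturals so that the union over all translates of
    \<open>Y\<close> can be made disjoint with \<open>disjointed\<close>.\<close>
  define V where "V i = int_iterate T (from_nat i) -` Y" for i
  define Z where "Z = (\<Union>i. V i)"
  have Vb: "V i \<in> sets borel" for i unfolding V_def by (rule vimage_int_iterate_borel[OF Y(1)])
  then have Zb: "Z \<in> sets borel" by (auto simp: Z_def)
  have Zmem: "x \<in> Z \<longleftrightarrow> (\<exists>n::int. int_iterate T n x \<in> Y)" for x
    unfolding Z_def V_def by (auto, metis from_nat_to_nat)
  have "T x \<in> Z \<longleftrightarrow> x \<in> Z" for x
  proof -
    have "int_iterate T n (T x) = int_iterate T (n + 1) x" for n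
      using int_iterate_add[OF bij_T, of n 1] int_iterate_of_nat[of T 1] by simp
    then show ?thesis unfolding Zmem by (metis diff_add_cancel)
  qed
  then have "T -` Z = Z" by auto
  then have erg: "emeasure \<mu> Z = 0 \<or> emeasure \<mu> Z = 1" "emeasure \<nu> Z = 0 \<or> emeasure \<nu> Z = 1"
    using assms(1,2) Zb by (auto simp: ergodic_borel_prob_def)
  \<comment> \<open>The inverse iterate moves \<open>X\<close> into \<open>Y\<close> and preserves
    both measures.\<close>
  have posV: "emeasure \<nu> X \<le> emeasure \<mu> X" if X: "X \<in> sets borel" "X \<subseteq> V i" for X i
  proof -
    let ?n = "from_nat i :: int"
    have "int_iterate T (- ?n) -` X \<subseteq> Y"
    proof
      fix x assume "x \<in> int_iterate T (- ?n) -` X"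
      then have "int_iterate T ?n (int_iterate T (- ?n) x) \<in> Y" using X(2) by (auto simp: V_def)
      then show "x \<in> Y" using int_iterate_add[OF bij_T, of ?n "- ?n"] by (simp add: fun_eq_iff)
    qed
    then show ?thesis
      using Y(2)[OF vimage_int_iterate_borel[OF X(1)]] inv X(1) by (metis invariant_int_iterate)
  qed
  have pos: "emeasure \<nu> X \<le> emeasure \<mu> X" if X: "X \<in> sets borel" "X \<subseteq> Z" for X
  proof -
    \<comment> \<open>Cuts \<open>X\<close> into disjoint pieces, each inside a single translate of
      \<open>Y\<close>, so that \<open>posV\<close> can be summed.\<close>
    define D where "D i = X \<inter> disjointed V i" for i
    have D: "range D \<subseteq> sets borel" "disjoint_family D" "(\<Union>i. D i) = X"
    proof -
      have "range (disjointed V) \<subseteq> sets borel"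
        using Vb by (intro sets.range_disjointed_sets) auto
      then show "range D \<subseteq> sets borel" using X by (auto simp: D_def)
      show "disjoint_family D"
        using disjoint_family_disjointed[of V] by (auto simp: disjoint_family_on_def D_def)
      show "(\<Union>i. D i) = X"
        using X(2) UN_disjointed_eq[of V] by (auto simp: D_def Z_def)
    qed
    have "emeasure \<nu> X = (\<Sum>i. emeasure \<nu> (D i))"
      using suminf_emeasure[of D \<nu>] D sets by simp
    also have "\<dots> \<le> (\<Sum>i. emeasure \<mu> (D i))"
      using D(1) disjointed_subset[of V] by (intro suminf_le summableI posV) (auto simp: D_def)
    also have "\<dots> = emeasure \<mu> X"
      using suminf_emeasure[of D \<mu>] D sets by simp
    finally show ?thesis .
  qed
  have neg: "emeasure \<mu> X \<le> emeasure \<nu> X" if X: "X \<in> sets borel" "X \<inter> Z = {}" for X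
  proof (rule Y(3)[OF X(1)])
    have "Y \<subseteq> Z" using Zmem by (metis int_iterate_0 id_apply subsetI)
    then show "X \<inter> Y = {}" using X(2) by auto
  qed
  have split: "emeasure \<rho> A = emeasure \<rho> (A \<inter> Z) + emeasure \<rho> (A - Z)"
    if "sets \<rho> = sets borel" "A \<in> sets borel" for \<rho> A
  proof -
    have "A \<inter> Z \<inter> (A - Z) = {}" by auto
    then show ?thesis using that Zb plus_emeasure[of "A \<inter> Z" \<rho> "A - Z"] by (simp add: Int_Diff_Un)
  qed
  show thesis
  proof (cases "emeasure \<mu> Z = 1 \<and> emeasure \<nu> Z = 0")
    case True
    then show ?thesis using that Zb by blast
  next
    case False
    \<comment> \<open>By \<open>pos\<close>, \<open>\<nu>\<close> cannot give \<open>Z\<close> more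
      mass than \<open>\<mu>\<close>, so only equal masses are left. Then either \<open>Z\<close> or
      its complement is null for both measures, and on the rest one measure dominates the
      other.\<close>
    then consider "emeasure \<mu> Z = 0" "emeasure \<nu> Z = 0" | "emeasure \<mu> Z = 1" "emeasure \<nu> Z = 1"
      using erg pos[OF Zb] by auto
    then have "\<mu> = \<nu>"
    proof cases
      case 1
      have "\<nu> = \<mu>"
      proof (rule prob_measure_le_imp_eq)
        fix A assume "A \<in> sets \<nu>"
        then have A: "A \<in> sets borel" using sets by simp
        have "emeasure \<mu> (A \<inter> Z) = 0"
          using 1 Zb sets by (metis emeasure_eq_0 inf_le2)
        then show "emeasure \<mu> A \<le> emeasure \<nu> A"
          using split[OF sets(1) A] split[OF sets(2) A] neg[of "A - Z"] A Zb Diff_disjoint[of Z A, unfolded Int_commute[of Z]]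
          by (simp add: add_increasing)
      qed (use sets pr in auto)
      then show ?thesis by simp
    next
      case 2
      show ?thesis
      proof (rule prob_measure_le_imp_eq)
        fix A assume "A \<in> sets \<mu>"
        then have A: "A \<in> sets borel" using sets by simp
        have "emeasure \<nu> (UNIV - Z) = 0"
          using N.prob_compl[of Z] 2(2) Zb sets sets_eq_imp_space_eq[OF sets(2)]
          by (simp add: N.emeasure_eq_measure)
        then have "emeasure \<nu> (A - Z) = 0"
          using Zb sets by (metis emeasure_eq_0 Diff_mono sets.Diff sets.top space_borel subset_UNIV subset_refl)
        then show "emeasure \<nu> A \<le> emeasure \<mu> A"
          using split[OF sets(1) A] split[OF sets(2) A] pos[of "A \<inter> Z"] A Zb
          by (simp add: add_increasing2)
      qed (use sets pr in auto)
    qed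
    with assms(3) show ?thesis by simp
  qed
qed

lemma finite_ergodic:
  assumes metr: "metrizable_space (euclidean :: 'a topology)"
    and F: "finite F" "closure (span (translates T F)) = UNIV"
  shows "finite {\<mu>. ergodic_borel_prob T \<mu>}"
proof (rule ccontr)
  assume "infinite {\<mu>. ergodic_borel_prob T \<mu>}"
  then obtain E where E: "finite E" "card E = Suc (card F)" "E \<subseteq> {\<mu>. ergodic_borel_prob T \<mu>}"
    using infinite_arbitrarily_large by blast
  obtain c where c: "\<exists>\<mu>\<in>E. c \<mu> \<noteq> 0" "\<And>f. f \<in> F \<Longrightarrow> (\<Sum>\<mu>\<in>E. c \<mu> * (\<integral>x. f x \<partial>\<mu>)) = 0"
    using homogeneous_system_nontrivial[OF F(1) E(1), of "\<lambda>f \<mu>. \<integral>x. f x \<partial>\<mu>"] E(2) by auto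
  have erg: "ergodic_borel_prob T \<mu>" and inv: "invariant_borel_prob T \<mu>"
    and sets: "sets \<mu> = sets borel" and pr: "prob_space \<mu>" if "\<mu> \<in> E" for \<mu>
    using E(3) that by (auto simp: ergodic_borel_prob_def invariant_borel_prob_def)
  \<comment> \<open>Invariance lets this functional vanish on all translates of the generators, and
    continuity carries this over to the closure of their span.\<close>
  define \<Lambda> where "\<Lambda> f = (\<Sum>\<mu>\<in>E. c \<mu> * (\<integral>x. f x \<partial>\<mu>))" for f :: "'a \<Rightarrow>\<^sub>C real"
  have bl: "bounded_linear \<Lambda>"
    unfolding \<Lambda>_def
    by (intro bounded_linear_sum bounded_linear_const_mult bounded_linear_integral_bcontfun sets pr)
  have "closed {f. \<Lambda> f = 0}"
    using bl by (intro closed_Collect_eq linear_continuous_on continuous_on_const)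
  moreover have "span (translates T F) \<subseteq> {f. \<Lambda> f = 0}"
  proof (rule span_minimal)
    have "\<Lambda> (translate n f) = \<Lambda> f" for n f
      unfolding \<Lambda>_def by (intro sum.cong refl arg_cong2[where f = "(*)"] integral_translate inv)
    then show "translates T F \<subseteq> {f. \<Lambda> f = 0}"
      using c(2) by (auto simp: translates_eq \<Lambda>_def)
    show "subspace {f. \<Lambda> f = 0}"
      using linear_subspace_kernel bounded_linear.linear[OF bl] by blast
  qed
  ultimately have "\<Lambda> f = 0" for f
    using F(2) closure_minimal by blast
  then have zero: "(\<Sum>\<mu>\<in>E. c \<mu> * measure \<mu> A) = 0" if "A \<in> sets borel" for A
    using that unfolding \<Lambda>_def by (intro signed_measure_eq_0[OF metr sets pr])
  obtain \<mu> where \<mu>: "\<mu> \<in> E" "c \<mu> \<noteq> 0" using c(1) by blast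
  have "\<exists>B. B \<in> sets borel \<and> emeasure \<nu> B = 1 \<and> emeasure \<mu> B = 0" if "\<nu> \<in> E - {\<mu>}" for \<nu>
    using ergodic_separated[of \<nu> \<mu>] erg \<mu> that by (metis DiffD1 DiffD2 singletonI)
  then obtain B where B: "\<And>\<nu>. \<nu> \<in> E - {\<mu>} \<Longrightarrow> B \<nu> \<in> sets borel \<and> emeasure \<nu> (B \<nu>) = 1 \<and> emeasure \<mu> (B \<nu>) = 0"
    by metis
  \<comment> \<open>Null for \<open>\<mu>\<close> and of full measure for every other member of
    \<open>E\<close>. Comparing the relation for \<open>A\<close> with the one for
    \<open>UNIV\<close> isolates \<open>c \<mu>\<close>.\<close>
  define A where "A = (\<Union>\<nu>\<in>E - {\<mu>}. B \<nu>)"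
  have A: "A \<in> sets borel" unfolding A_def using B E(1) by (intro sets.finite_UN) auto
  have \<mu>A: "measure \<mu> A = 0"
  proof -
    have "A \<in> null_sets \<mu>"
      unfolding A_def using B E(1) sets[OF \<mu>(1)]
      by (intro null_sets_UN' countable_finite) (auto simp: null_sets_def)
    then show ?thesis by (simp add: measure_def null_sets_def)
  qed
  have \<nu>A: "measure \<nu> A = 1" if "\<nu> \<in> E - {\<mu>}" for \<nu>
  proof -
    interpret prob_space \<nu> using pr that by blast
    have "measure \<nu> (B \<nu>) = 1" using B[OF that] by (simp add: measure_def)
    moreover have "measure \<nu> (B \<nu>) \<le> measure \<nu> A"
      using that A sets[of \<nu>] by (intro finite_measure_mono) (auto simp: A_def)
    ultimately show ?thesis using prob_le_1[of A] by simp
  qed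
  have "(\<Sum>\<nu>\<in>E. c \<nu>) = 0"
  proof -
    have "measure \<nu> UNIV = 1" if "\<nu> \<in> E" for \<nu>
      using prob_space.prob_space[OF pr[OF that]] sets_eq_imp_space_eq[OF sets[OF that]] by simp
    then show ?thesis using zero[of UNIV] by simp
  qed
  moreover have "(\<Sum>\<nu>\<in>E. c \<nu> * measure \<nu> A) = (\<Sum>\<nu>\<in>E - {\<mu>}. c \<nu>)"
    using \<mu> E(1) \<mu>A \<nu>A by (simp add: sum.remove)
  ultimately show False
    using zero[OF A] \<mu> E(1) by (simp add: sum.remove)
qed

end

section \<open>Independence sets from positive entropy\<close>

text \<open>Urysohn functions at the points of the space, reduced to finitely many by compactness.
  The value 1 is attained exactly, so that the point lies above every threshold \<open>m / M\<close>
  with \<open>m < M\<close>.\<close>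

lemma open_cover_functions:
  fixes \<U> :: "'a::topological_space set set"
  assumes "compact (UNIV :: 'a set)" "metrizable_space (euclidean :: 'a topology)" "open_cover \<U>"
  obtains I :: "'a set" and f :: "'a \<Rightarrow> 'a \<Rightarrow> real" and U :: "'a \<Rightarrow> 'a set"
  where "finite I" "\<And>i. continuous_on UNIV (f i)" "\<And>i. U i \<in> \<U>"
    "\<And>i x. f i x > 0 \<Longrightarrow> x \<in> U i" "\<And>x. \<exists>i\<in>I. f i x = 1"
proof -
  have cr: "completely_regular_space (euclidean :: 'a topology)"
    by (rule metrizable_imp_completely_regular_space[OF assms(2)])
  have "\<exists>V f. V \<in> \<U> \<and> continuous_on UNIV f \<and> f x = (1::real) \<and> (\<forall>y. y \<notin> V \<longrightarrow> f y = 0)" for x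
  proof -
    obtain V where V: "V \<in> \<U>" "x \<in> V" "open V"
      using assms(3) unfolding open_cover_def by blast
    then have "closedin euclidean (- V) \<and> x \<in> topspace euclidean - (- V)"
      by (simp add: closed_Compl)
    then obtain h :: "'a \<Rightarrow> real" where h: "continuous_map euclidean (top_of_set {0..1}) h"
      "h x = 0" "h ` (- V) \<subseteq> {1}"
      using cr unfolding completely_regular_space_def by blast
    then have "continuous_on UNIV (\<lambda>y. 1 - h y)"
      by (intro continuous_intros) (simp add: continuous_map_in_subtopology)
    then show ?thesis using V h by (intro exI[of _ V] exI[of _ "\<lambda>y. 1 - h y"]) auto
  qed
  then obtain U g where g: "\<And>x. U x \<in> \<U>" "\<And>x. continuous_on UNIV (g x)" "\<And>x. g x x = (1::real)"
    "\<And>x y. y \<notin> U x \<Longrightarrow> g x y = 0"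
    by metis
  have op: "open {y. g x y > 1/2}" for x
    using g(2)[of x] by (intro open_Collect_less continuous_intros) auto
  have "UNIV \<subseteq> (\<Union>x. {y. g x y > 1/2})"
  proof
    fix x show "x \<in> (\<Union>x. {y. g x y > 1/2})" by (rule UN_I[of x]) (auto simp: g(3))
  qed
  then obtain I where I: "finite I" "UNIV \<subseteq> (\<Union>x\<in>I. {y. g x y > 1/2})"
    using compactE_image[OF assms(1), of UNIV "\<lambda>x. {y. g x y > 1/2}"] op by auto
  show thesis
  \<comment> \<open>Compactness only yields values above 1/2; doubling and truncating raises them to
    1 without enlarging the set of positivity.\<close>
  proof (rule that[of I "\<lambda>i y. min 1 (2 * g i y)" U])
    show "finite I" by fact
    show "continuous_on UNIV (\<lambda>y. min 1 (2 * g i y))" for i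
      using g(2)[of i] by (intro continuous_intros)
    show "U i \<in> \<U>" for i by (rule g(1))
    show "x \<in> U i" if "min 1 (2 * g i x) > 0" for i x
      using that g(4)[of x i] by fastforce
    show "\<exists>i\<in>I. min 1 (2 * g i x) = 1" for x
    proof -
      obtain i where "i \<in> I" "g i x > 1/2" using I(2) by auto
      then show ?thesis by (intro bexI[of _ i]) auto
    qed
  qed
qed

section \<open>Names of orbits and counting of joins\<close>

definition itinerary :: "('a \<Rightarrow> 'a) \<Rightarrow> ('a \<Rightarrow> bool) \<Rightarrow> nat \<Rightarrow> 'a \<Rightarrow> nat set" where
  "itinerary T P n x = {j. j < n \<and> P ((T ^^ j) x)}"

definition above :: "real \<Rightarrow> nat \<Rightarrow> ('a \<Rightarrow> real) \<Rightarrow> 'a \<Rightarrow> bool" where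
  "above M m f x \<longleftrightarrow> real m < M * f x"

text \<open>Strict on both sides: bands for different \<open>m\<close> are disjoint, and off the
  band \<open>M * f x\<close> is either at most \<open>m\<close> or at least \<open>m + 1\<close>, a
  gap of fixed size.\<close>

definition in_band :: "real \<Rightarrow> nat \<Rightarrow> ('a \<Rightarrow> real) \<Rightarrow> 'a \<Rightarrow> bool" where
  "in_band M m f x \<longleftrightarrow> real m < M * f x \<and> M * f x < real m + 1"

lemma finite_itinerary [simp]: "finite (itinerary T P n x)"
  by (simp add: itinerary_def)

text \<open>Pigeonhole: the visits to the \<open>M\<close> disjoint bands are disjoint sets of times
  below \<open>n\<close>.\<close>

lemma rarely_visited_band:
  fixes M :: nat
  assumes "M > 0"
  shows "\<exists>m<M. M * card (itinerary T (in_band (real M) m f) n x) \<le> n"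
proof (rule ccontr)
  let ?S = "\<lambda>m. itinerary T (in_band (real M) m f) n x"
  assume "\<not> ?thesis"
  then have "\<And>m. m < M \<Longrightarrow> n < M * card (?S m)" by auto
  then have "(\<Sum>m<M. n) < (\<Sum>m<M. M * card (?S m))"
    using assms by (intro sum_strict_mono) auto
  then have "n < (\<Sum>m<M. card (?S m))"
    using assms by (simp flip: sum_distrib_left)
  also have "\<dots> = card (\<Union>m<M. ?S m)"
  proof (subst card_UN_disjoint)
    show "\<forall>i\<in>{..<M}. \<forall>j\<in>{..<M}. i \<noteq> j \<longrightarrow> ?S i \<inter> ?S j = {}"
      unfolding itinerary_def in_band_def by (auto simp: linorder_neq_iff)
  qed auto
  also have "\<dots> \<le> card {..<n}"
    by (intro card_mono) (auto simp: itinerary_def)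
  finally show False by simp
qed

text \<open>The code of a point consists of the names of its orbit with respect to one rarely visited band
  for each function. Points with the same code lie in a common element of the join, since any name
  of a point with \<open>f i x = 1\<close> forces \<open>f i > 0\<close>.\<close>
lemma cover_number_le_names:
  fixes M B :: nat and f :: "'i \<Rightarrow> 'a \<Rightarrow> real" and T :: "'a \<Rightarrow> 'a"
  assumes I: "finite I" and M: "M > 0"
    and U: "\<And>i. U i \<in> \<U>" "\<And>i x. f i x > 0 \<Longrightarrow> x \<in> U i" "\<And>x. \<exists>i\<in>I. f i x = 1"
    and B: "\<And>i m. i \<in> I \<Longrightarrow> m < M \<Longrightarrow>
      card (itinerary T (above M m (f i)) n ` {x. M * card (itinerary T (in_band M m (f i)) n x) \<le> n}) \<le> B"
  shows "cover_number (iterated_join T \<U> n) \<le> (M * B) ^ card I"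
proof -
  define name where "name i m = itinerary T (above M m (f i)) n" for i m
  define S where "S i m = {x. M * card (itinerary T (in_band M m (f i)) n x) \<le> n}" for i m
  have ex: "\<exists>m. m < M \<and> x \<in> S i m" for i x
    using rarely_visited_band[OF M, of T "f i" n x] by (simp add: S_def)
  \<comment> \<open>The rare band depends on the point, so its number is recorded in the code; this
    accounts for the factor \<open>M\<close> in the bound.\<close>
  define b where "b i x = (SOME m. m < M \<and> x \<in> S i m)" for i x
  have b: "b i x < M" "x \<in> S i (b i x)" for i x
    using someI_ex[OF ex[of x i]] by (simp_all add: b_def)
  define code where "code x = (\<lambda>i\<in>I. (b i x, name i (b i x) x))" for x
  have fin: "finite (name i m ` S i m)" for i m
    by (rule finite_subset[of _ "Pow {..<n}"]) (auto simp: name_def itinerary_def)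
  define Q where "Q = (\<Pi>\<^sub>E i\<in>I. SIGMA m:{..<M}. name i m ` S i m)"
  have codeQ: "range code \<subseteq> Q"
    using b by (auto simp: code_def Q_def)
  have finQ: "finite Q" unfolding Q_def using I fin by (intro finite_PiE) auto
  have "card Q = (\<Prod>i\<in>I. \<Sum>m<M. card (name i m ` S i m))"
    unfolding Q_def using I fin by (simp add: card_PiE)
  also have "\<dots> \<le> (\<Prod>i\<in>I. \<Sum>m<M. B)"
    using B unfolding name_def S_def by (intro prod_mono conjI sum_mono) auto
  also have "\<dots> = (M * B) ^ card I" by simp
  finally have cQ: "card Q \<le> (M * B) ^ card I" .
  define r where "r c = (SOME x. code x = c)" for c
  have r: "code (r (code x)) = code x" for x
    unfolding r_def by (rule someI) simp
  define k where "k y = (SOME i. i \<in> I \<and> f i y = 1)" for y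
  have k: "k y \<in> I" "f (k y) y = 1" for y
    using someI_ex[of "\<lambda>i. i \<in> I \<and> f i y = 1"] U(3)[of y] by (auto simp: k_def)
  \<comment> \<open>At each time the cell uses a set \<open>U i\<close> whose function equals 1 at
    the orbit of the representative \<open>r c\<close>; \<open>k\<close> picks the index.\<close>
  define cell where "cell c = (\<Inter>j<n. (T ^^ j) -` U (k ((T ^^ j) (r c))))" for c
  let ?V = "cell ` range code"
  have "?V \<subseteq> iterated_join T \<U> n"
  proof
    fix D assume "D \<in> ?V"
    then obtain c where "D = cell c" by blast
    define A where "A j = U (k ((T ^^ j) (r c)))" for j
    have "D = (\<Inter>j<n. (T ^^ j) -` A j)" by (simp only: \<open>D = cell c\<close> cell_def A_def)
    moreover have "\<forall>j<n. A j \<in> \<U>" by (simp add: A_def U(1))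
    ultimately show "D \<in> iterated_join T \<U> n"
      unfolding iterated_join_def mem_Collect_eq by (intro exI[of _ A] conjI)
  qed
  moreover have "finite ?V" by (intro finite_imageI finite_subset[OF codeQ finQ])
  moreover have "\<Union> ?V = UNIV"
  proof -
    have "y \<in> cell (code y)" for y
      unfolding cell_def
    proof (intro INT_I vimageI2)
      fix j assume j: "j \<in> {..<n}"
      define x where "x = r (code y)"
      define i where "i = k ((T ^^ j) x)"
      have i: "i \<in> I" "f i ((T ^^ j) x) = 1" using k by (auto simp: i_def)
      have "code x = code y" unfolding x_def by (rule r)
      then have "code x i = code y i" by (rule fun_cong)
      then have "(b i x, name i (b i x) x) = (b i y, name i (b i y) y)"
        unfolding code_def restrict_apply'[OF i(1)] .
      then have bb: "b i x = b i y" "name i (b i x) x = name i (b i y) y"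
        unfolding prod.inject by blast+
      have "j \<in> name i (b i x) x"
        using j i b(1)[of i x] by (simp add: name_def itinerary_def above_def)
      then have "j \<in> name i (b i y) y" by (simp only: bb(2))
      then have "real (b i y) < M * f i ((T ^^ j) y)"
        by (simp add: name_def itinerary_def above_def)
      then have "0 < M * f i ((T ^^ j) y)" using of_nat_0_le_iff[of "b i y", where 'a = real] by linarith
      then have "f i ((T ^^ j) y) > 0" using M by (simp add: zero_less_mult_iff)
      then show "(T ^^ j) y \<in> U (k ((T ^^ j) (r (code y))))"
        using U(2) by (simp add: i_def x_def)
    qed
    then show ?thesis by blast
  qed
  ultimately have "cover_number (iterated_join T \<U> n) \<le> card ?V"
    unfolding cover_number_def by (intro Least_le) blast
  also have "\<dots> \<le> card (range code)"
    by (intro card_image_le finite_subset[OF codeQ finQ])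
  also have "\<dots> \<le> card Q" by (rule card_mono[OF finQ codeQ])
  finally show ?thesis using cQ by simp
qed

text \<open>A name is determined by the set \<open>Q\<close> of visits to the band, its part outside \<open>Q\<close> and its
  part inside \<open>Q\<close>. For each \<open>Q\<close>, Pajor's lemma counts the parts outside by shattered sets.\<close>
lemma names_bound:
  fixes M :: nat and d :: real and f :: "'a \<Rightarrow> real"
  assumes M: "M > 0" "1 \<le> d * M"
    and sh: "\<And>W. W \<subseteq> {..<n} \<Longrightarrow>
      (\<forall>V\<subseteq>W. \<exists>x. \<forall>j\<in>W. if j \<in> V then real m + 1 \<le> M * f ((T ^^ j) x) else M * f ((T ^^ j) x) \<le> m) \<Longrightarrow>
      real (card W) \<le> d * n"
  shows "card (itinerary T (above M m f) n ` {x. M * card (itinerary T (in_band M m f) n x) \<le> n})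
    \<le> card {Q. Q \<subseteq> {..<n} \<and> card Q \<le> d * n} ^ 3"
proof -
  define name where "name = itinerary T (above M m f) n"
  define star where "star = itinerary T (in_band M m f) n"
  define S where "S = {x. M * card (star x) \<le> n}"
  define \<Q> where "\<Q> = {Q. Q \<subseteq> {..<n} \<and> card Q \<le> d * n}"
  define G where "G Q = (\<lambda>x. name x - Q) ` {x. star x = Q}" for Q
  have sub: "name x \<subseteq> {..<n}" "star x \<subseteq> {..<n}" for x
    by (auto simp: name_def star_def itinerary_def)
  have fin\<Q>: "finite \<Q>" by (simp add: \<Q>_def)
  have GP: "G Q \<subseteq> Pow {..<n}" for Q using sub by (auto simp: G_def)
  have finG: "finite (G Q)" for Q using GP finite_subset by (metis finite_Pow_iff finite_lessThan)
  have cG: "card (G Q) \<le> card \<Q>" for Q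
  proof -
    have "card (G Q) \<le> card {W. W \<subseteq> {..<n} \<and> shatters (G Q) W}"
      using card_le_card_shattered[OF _ GP] by simp
    also have "\<dots> \<le> card \<Q>"
    proof (rule card_mono[OF fin\<Q>], rule subsetI, elim CollectE conjE)
      fix W assume W: "W \<subseteq> {..<n}" "shatters (G Q) W"
      \<comment> \<open>The full trace on \<open>W\<close> comes from a set avoiding
        \<open>Q\<close>. So no time in \<open>W\<close> is a visit to the band, and membership in
        the name becomes the dichotomy across the gap.\<close>
      obtain A where "A \<in> G Q" "A \<inter> W = W" using W(2) unfolding shatters_def by blast
      then have WQ: "W \<inter> Q = {}" by (auto simp: G_def)
      have "\<exists>x. \<forall>j\<in>W. if j \<in> V then real m + 1 \<le> M * f ((T ^^ j) x) else M * f ((T ^^ j) x) \<le> m"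
        if V: "V \<subseteq> W" for V
      proof -
        obtain A where A: "A \<in> G Q" "A \<inter> W = V" using W(2) V unfolding shatters_def by blast
        then obtain x where x: "star x = Q" "A = name x - Q" by (auto simp: G_def)
        have "if j \<in> V then real m + 1 \<le> M * f ((T ^^ j) x) else M * f ((T ^^ j) x) \<le> m"
          if j: "j \<in> W" for j
        proof -
          have "j < n" "j \<notin> Q" using j W(1) WQ by auto
          then have "j \<notin> star x" "j \<in> V \<longleftrightarrow> j \<in> name x" using x A(2) j by auto
          then show ?thesis using \<open>j < n\<close>
            by (auto simp: star_def name_def itinerary_def in_band_def above_def)
        qed
        then show ?thesis by blast
      qed
      then have "real (card W) \<le> d * n" by (intro sh[OF W(1)]) blast
      then show "W \<in> \<Q>" using W(1) by (simp add: \<Q>_def)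
    qed
    finally show ?thesis .
  qed
  \<comment> \<open>Three factors: \<open>Q\<close> itself, the part outside \<open>Q\<close>, and
    the part inside \<open>Q\<close>, which is small because \<open>Q\<close> is.\<close>
  have "name ` S \<subseteq> (\<Union>Q\<in>\<Q>. (\<lambda>(g, q). g \<union> q) ` (G Q \<times> \<Q>))"
  proof
    fix \<nu> assume "\<nu> \<in> name ` S"
    then obtain x where x: "x \<in> S" "\<nu> = name x" by blast
    have "real M * card (star x) \<le> n" using x(1) unfolding S_def by (metis mem_Collect_eq of_nat_le_iff of_nat_mult)
    moreover have "real (card (star x)) * 1 \<le> card (star x) * (d * M)"
      using M by (intro mult_left_mono) auto
    moreover have "d * (real M * card (star x)) \<le> d * n"
    proof (rule mult_left_mono)
      show "0 \<le> d" using M by (metis less_eq_real_def mult_nonpos_nonneg not_one_le_zero of_nat_0_le_iff order_trans linorder_le_cases)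
    qed fact
    ultimately have c: "card (star x) \<le> d * n" by (simp add: mult.commute mult.left_commute)
    have "real (card (name x \<inter> star x)) \<le> card (star x)"
      using finite_itinerary[of T _ n x] by (simp add: star_def card_mono)
    then have "star x \<in> \<Q>" "name x \<inter> star x \<in> \<Q>"
      using c sub by (auto simp: \<Q>_def)
    moreover have "name x - star x \<in> G (star x)" by (auto simp: G_def)
    moreover have "\<nu> = (\<lambda>(g, q). g \<union> q) (name x - star x, name x \<inter> star x)"
      by (auto simp: x(2))
    ultimately show "\<nu> \<in> (\<Union>Q\<in>\<Q>. (\<lambda>(g, q). g \<union> q) ` (G Q \<times> \<Q>))"
      by (intro UN_I[of "star x"] image_eqI[of _ _ "(name x - star x, name x \<inter> star x)"] SigmaI)
  qed
  then have "card (name ` S) \<le> card (\<Union>Q\<in>\<Q>. (\<lambda>(g, q). g \<union> q) ` (G Q \<times> \<Q>))"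
    using fin\<Q> finG by (intro card_mono) auto
  also have "\<dots> \<le> (\<Sum>Q\<in>\<Q>. card ((\<lambda>(g, q). g \<union> q) ` (G Q \<times> \<Q>)))"
    by (rule card_UN_le[OF fin\<Q>])
  also have "\<dots> \<le> (\<Sum>Q\<in>\<Q>. card \<Q> * card \<Q>)"
  proof (rule sum_mono)
    fix Q
    have "card ((\<lambda>(g, q). g \<union> q) ` (G Q \<times> \<Q>)) \<le> card (G Q \<times> \<Q>)"
      using finG fin\<Q> by (intro card_image_le) auto
    also have "\<dots> \<le> card \<Q> * card \<Q>" using cG by (simp add: card_cartesian_product)
    finally show "card ((\<lambda>(g, q). g \<union> q) ` (G Q \<times> \<Q>)) \<le> card \<Q> * card \<Q>" .
  qed
  finally show ?thesis
    by (simp add: name_def S_def star_def \<Q>_def power3_eq_cube mult.assoc)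
qed

text \<open>For any \<open>n\<close> without such \<open>g\<close> and \<open>W\<close>, counting
  names bounds the cover number. If this happened for all large \<open>n\<close>, the growth rate
  would be at most \<open>\<eta>\<close>, which lies below the entropy of the cover.\<close>

lemma positive_entropy_independence:
  fixes T :: "'a::topological_space \<Rightarrow> 'a"
  assumes "compact (UNIV :: 'a set)" "metrizable_space (euclidean :: 'a topology)"
    and \<U>: "open_cover \<U>" "cover_entropy T \<U> > 0"
  obtains G :: "('a \<Rightarrow>\<^sub>C real) set" and d :: real where "finite G" "d > 0"
    "\<exists>\<^sub>F n in sequentially. \<exists>g\<in>G. \<exists>W\<subseteq>{..<n}. real (card W) > d * n \<and>
      (\<forall>V\<subseteq>W. \<exists>x. \<forall>j\<in>W. apply_bcontfun g ((T ^^ j) x) = (if j \<in> V then 1 else -1))"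
proof -
  obtain I :: "'a set" and f :: "'a \<Rightarrow> 'a \<Rightarrow> real" and U where I: "finite I" and
    f: "\<And>i. continuous_on UNIV (f i)" and U: "\<And>i. U i \<in> \<U>"
    "\<And>i x. f i x > 0 \<Longrightarrow> x \<in> U i" "\<And>x. \<exists>i\<in>I. f i x = 1"
    by (rule open_cover_functions[OF assms(1-2) \<U>(1)]) blast
  have I0: "card I > 0" using I U(3) by (metis card_gt_0_iff empty_iff)
  obtain \<eta> :: real where \<eta>: "\<eta> > 0" "ereal \<eta> < cover_entropy T \<U>"
    using \<U>(2) by (metis ereal_dense2 ereal_less(2))
  \<comment> \<open>The 6 is 3 times 2: the cube in \<open>names_bound\<close>, and a spare half of
    \<open>\<eta>\<close> that absorbs the constant \<open>card I * ln M\<close>.\<close>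
  define a where "a = \<eta> / (6 * card I)"
  have a: "a > 0" using \<eta> I0 by (simp add: a_def)
  obtain d :: real where d: "d > 0"
    "\<And>n. real (card {Q. Q \<subseteq> {..<n::nat} \<and> card Q \<le> d * n}) \<le> exp (a * n)"
    using few_small_subsets[OF a] by blast
  \<comment> \<open>Enough bands for the rarely visited one to have at most \<open>d * n\<close>
    visits.\<close>
  define M where "M = nat \<lceil>1 / d\<rceil>"
  have M: "M > 0" "1 \<le> d * M"
  proof -
    have "1 / d \<le> M" unfolding M_def using d(1) by linarith
    then show "1 \<le> d * M" using d(1) by (simp add: field_simps)
    then show "M > 0" by (cases M) auto
  qed
  \<comment> \<open>A truncated affine function of \<open>f i\<close> that turns the gap into exact
    signs: it is -1 where \<open>M * f i x\<close> is at most \<open>m\<close> and 1 where it is at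
    least \<open>m + 1\<close>.\<close>
  have "\<exists>g::'a \<Rightarrow>\<^sub>C real. \<forall>x. apply_bcontfun g x = max (- 1) (min 1 (2 * (real M * f i x - real m) - 1))" for i and m :: nat
  proof -
    have "(\<lambda>x. max (- 1) (min 1 (2 * (real M * f i x - real m) - 1))) \<in> bcontfun"
      using f[of i] by (intro bcontfun_normI[of _ 1] continuous_intros) auto
    then show ?thesis by (metis bcontfunE)
  qed
  then obtain \<gamma> :: "'a \<Rightarrow> nat \<Rightarrow> 'a \<Rightarrow>\<^sub>C real"
    where \<gamma>: "\<And>i m x. \<gamma> i m x = max (- 1) (min 1 (2 * (real M * f i x - real m) - 1))"
    by metis
  define G where "G = (\<lambda>(i, m). \<gamma> i m) ` (I \<times> {..<M})"
  define ind where "ind n \<longleftrightarrow> (\<exists>g\<in>G. \<exists>W\<subseteq>{..<n}. real (card W) > d * n \<and>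
      (\<forall>V\<subseteq>W. \<exists>x. \<forall>j\<in>W. apply_bcontfun g ((T ^^ j) x) = (if j \<in> V then 1 else -1)))" for n
  have bound: "ln (cover_number (iterated_join T \<U> n)) \<le> card I * ln M + \<eta> / 2 * n"
    if "\<not> ind n" for n
  proof -
    define B where "B = card {Q. Q \<subseteq> {..<n::nat} \<and> card Q \<le> d * n} ^ 3"
    have "cover_number (iterated_join T \<U> n) \<le> (M * B) ^ card I"
    proof (rule cover_number_le_names[OF I M(1) U])
      fix i m assume im: "i \<in> I" "m < M"
      show "card (itinerary T (above M m (f i)) n ` {x. M * card (itinerary T (in_band M m (f i)) n x) \<le> n}) \<le> B"
        unfolding B_def
      proof (rule names_bound[OF M])
        fix W assume W: "W \<subseteq> {..<n}" and
          sh: "\<forall>V\<subseteq>W. \<exists>x. \<forall>j\<in>W. if j \<in> V then real m + 1 \<le> M * f i ((T ^^ j) x) else M * f i ((T ^^ j) x) \<le> m"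
        show "real (card W) \<le> d * n"
        proof (rule ccontr)
          assume "\<not> real (card W) \<le> d * n"
          moreover have "\<exists>x. \<forall>j\<in>W. \<gamma> i m ((T ^^ j) x) = (if j \<in> V then 1 else -1)" if V: "V \<subseteq> W" for V
          proof -
            obtain x where x: "\<forall>j\<in>W. if j \<in> V then real m + 1 \<le> M * f i ((T ^^ j) x) else M * f i ((T ^^ j) x) \<le> m"
              using sh V by blast
            have "\<gamma> i m ((T ^^ j) x) = (if j \<in> V then 1 else -1)" if "j \<in> W" for j
            proof (cases "j \<in> V")
              case True
              then have "real m + 1 \<le> M * f i ((T ^^ j) x)" using bspec[OF x that] by simp
              then show ?thesis using True by (simp add: \<gamma>)
            next
              case False
              then have "M * f i ((T ^^ j) x) \<le> m" using bspec[OF x that] by simp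
              then show ?thesis using False by (simp add: \<gamma>)
            qed
            then show ?thesis by blast
          qed
          moreover have "\<gamma> i m \<in> G" using im by (auto simp: G_def)
          ultimately have "ind n" unfolding ind_def using W by (meson not_le)
          with \<open>\<not> ind n\<close> show False by simp
        qed
      qed
    qed
    then have "real (cover_number (iterated_join T \<U> n)) \<le> (M * real B) ^ card I"
      by (metis of_nat_le_iff of_nat_mult of_nat_power)
    also have "\<dots> \<le> (M * exp (3 * a * n)) ^ card I"
    proof (intro power_mono mult_left_mono)
      have "real B \<le> exp (a * n) ^ 3"
        unfolding B_def of_nat_power by (intro power_mono d(2)) auto
      then show "real B \<le> exp (3 * a * n)" by (simp add: mult.assoc flip: exp_of_nat_mult)
    qed auto
    finally have le: "real (cover_number (iterated_join T \<U> n)) \<le> (M * exp (3 * a * n)) ^ card I" .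
    have e: "ln ((M * exp (3 * a * n)) ^ card I) = card I * ln M + \<eta> / 2 * n"
      using M(1) I0 by (simp add: ln_realpow ln_mult a_def field_simps)
    show ?thesis
    proof (cases "cover_number (iterated_join T \<U> n) = 0")
      \<comment> \<open>Here \<open>ln 0 = 0\<close>, and the right-hand side is
        nonnegative.\<close>
      case True
      have "ln (real M) \<ge> 0" using M(1) by simp
      then show ?thesis using True \<eta> by simp
    next
      case False
      then have "ln (real (cover_number (iterated_join T \<U> n))) \<le> ln ((M * exp (3 * a * n)) ^ card I)"
        using le M(1) by (subst ln_le_cancel_iff) auto
      then show ?thesis using e by simp
    qed
  qed
  have "\<exists>\<^sub>F n in sequentially. ind n"
  proof (rule ccontr)
    assume "\<not> (\<exists>\<^sub>F n in sequentially. ind n)"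
    then have "\<forall>\<^sub>F n in sequentially. \<not> ind n" by (simp add: not_frequently)
    moreover have "\<forall>\<^sub>F n in sequentially. card I * ln M \<le> \<eta> / 2 * real n"
      using \<eta>(1) by real_asymp
    moreover have "\<forall>\<^sub>F n::nat in sequentially. n > 0" by (rule eventually_gt_at_top)
    ultimately have "\<forall>\<^sub>F n in sequentially.
      ereal (ln (real (cover_number (iterated_join T \<U> n))) / real n) \<le> ereal \<eta>"
    proof eventually_elim
      case (elim n)
      then show ?case using bound[of n] by (simp add: field_simps)
    qed
    then have "cover_entropy T \<U> \<le> ereal \<eta>"
      unfolding cover_entropy_def by (rule Limsup_bounded)
    with \<eta>(2) show False by simp
  qed
  then show thesis using that[of G d] I d(1) by (simp add: G_def ind_def)
qed

section \<open>Dimension count\<close>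

text \<open>As functions of \<open>V\<close> in \<open>Pow W\<close> these are the Rademacher
  functions; their products are the Walsh functions.\<close>

definition sign_in :: "'b set \<Rightarrow> 'b \<Rightarrow> real" where
  "sign_in V j = (if j \<in> V then 1 else -1)"

text \<open>Toggling \<open>t\<close> is an involution of \<open>Pow W\<close> that reverses the
  sign and preserves \<open>R\<close>.\<close>

lemma sum_sign_in_eq_0:
  assumes "t \<in> W" "\<And>V. R (insert t V) = R (V - {t})"
  shows "(\<Sum>V\<in>Pow W. sign_in V t * R V) = 0"
proof -
  define flip where "flip V = (if t \<in> V then V - {t} else insert t V)" for V
  have R: "R (flip V) = R V" for V
    using assms(2)[of V] by (cases "t \<in> V") (auto simp: flip_def insert_absorb)
  have "(\<Sum>V\<in>Pow W. sign_in V t * R V) = (\<Sum>V\<in>Pow W. sign_in (flip V) t * R (flip V))"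
    using assms(1) by (intro sum.reindex_bij_witness[of _ flip flip]) (auto simp: flip_def insert_absorb split: if_splits)
  also have "\<dots> = - (\<Sum>V\<in>Pow W. sign_in V t * R V)"
    unfolding R sum_negf[symmetric] by (intro sum.cong) (auto simp: flip_def sign_in_def)
  finally show ?thesis by simp
qed

lemma sum_sign_in_pairs:
  fixes u v u' v' :: nat
  assumes "finite W" "u \<in> W" "v \<in> W" "u' \<in> W" "v' \<in> W" "u < v" "u' < v'"
  shows "(\<Sum>V\<in>Pow W. (sign_in V u * sign_in V v) * (sign_in V u' * sign_in V v'))
    = (if (u, v) = (u', v') then 2 ^ card W else 0)"
proof (cases "(u, v) = (u', v')")
  case True
  then have "(\<Sum>V\<in>Pow W. (sign_in V u * sign_in V v) * (sign_in V u' * sign_in V v')) = (\<Sum>V\<in>Pow W. 1)"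
    by (intro sum.cong) (auto simp: sign_in_def)
  then show ?thesis using True assms(1) by (simp add: card_Pow)
next
  case False
  have inv: "sign_in (insert t V) w = sign_in (V - {t}) w" if "w \<noteq> t" for t w :: nat and V
    using that by (auto simp: sign_in_def)
  have *: "(\<Sum>V\<in>Pow W. sign_in V t * (sign_in V w * (sign_in V w' * sign_in V w''))) = 0"
    if "t \<in> W" "w \<noteq> t" "w' \<noteq> t" "w'' \<noteq> t" for t w w' w''
    using that by (intro sum_sign_in_eq_0) (auto simp: inv)
  \<comment> \<open>Because both pairs are increasing, distinct pairs cannot have the same elements.
    So \<open>u\<close> or \<open>v\<close> is absent from the other pair and its sign occurs only
    once in the product.\<close>
  consider "u \<noteq> u'" "u \<noteq> v'" | "v \<noteq> u'" "v \<noteq> v'"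
    using False assms(6,7) by fastforce
  then show ?thesis
  proof cases
    case 1
    then show ?thesis using False *[of u v u' v'] assms by (simp add: mult.assoc)
  next
    case 2
    then show ?thesis using False *[of v u u' v'] assms by (simp add: ac_simps)
  qed
qed

text \<open>With \<open>k\<close> the number of points this is the inner product for the uniform
  measure on the points \<open>p V\<close>. It is in general only semidefinite, as a function may
  vanish at all of them.\<close>

lemma semi_inner_points:
  fixes p :: "'c \<Rightarrow> 'a::topological_space"
  assumes "k \<ge> 0"
  shows "semi_inner (\<lambda>\<phi> \<psi> :: 'a \<Rightarrow>\<^sub>C real.
    (\<Sum>V\<in>A. apply_bcontfun \<phi> (p V) * apply_bcontfun \<psi> (p V)) / k)"
proof
  fix x y z :: "'a \<Rightarrow>\<^sub>C real" and c :: real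
  show "(\<Sum>V\<in>A. (x + y) (p V) * z (p V)) / k
    = (\<Sum>V\<in>A. x (p V) * z (p V)) / k + (\<Sum>V\<in>A. y (p V) * z (p V)) / k"
    by (simp add: distrib_right sum.distrib add_divide_distrib)
  show "(\<Sum>V\<in>A. (c *\<^sub>R x) (p V) * z (p V)) / k = c * ((\<Sum>V\<in>A. x (p V) * z (p V)) / k)"
    by (simp add: sum_distrib_left mult.assoc)
  show "(\<Sum>V\<in>A. x (p V) * y (p V)) / k = (\<Sum>V\<in>A. y (p V) * x (p V)) / k"
    by (simp add: mult.commute)
  show "0 \<le> (\<Sum>V\<in>A. x (p V) * x (p V)) / k"
    using assms by (intro divide_nonneg_nonneg sum_nonneg) auto
qed

section \<open>Translates in a bounded time window, and the final count\<close>

context homeomorphism_system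
begin

text \<open>A window of times keeps the set of translates finite, with size at most linear in the
  length of the window.\<close>

definition translates_between :: "('a \<Rightarrow>\<^sub>C real) set \<Rightarrow> int \<Rightarrow> int \<Rightarrow> ('a \<Rightarrow>\<^sub>C real) set" where
  "translates_between F a b = (\<lambda>(f, k). translate k f) ` (F \<times> {a..b})"

lemma translates_between_mono: "a' \<le> a \<Longrightarrow> b \<le> b' \<Longrightarrow> translates_between F a b \<subseteq> translates_between F a' b'"
  by (auto simp: translates_between_def)

lemma finite_translates_between: "finite F \<Longrightarrow> finite (translates_between F a b)"
  by (simp add: translates_between_def)

lemma card_translates_between:
  assumes "finite F"
  shows "card (translates_between F a b) \<le> card F * nat (b - a + 1)"
  unfolding translates_between_def using assms
  by (intro order_trans[OF card_image_le]) (auto simp: card_cartesian_product)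

text \<open>A linear combination involves finitely many translates only.\<close>

lemma span_translates_bounded:
  assumes "h \<in> span (translates T F)"
  shows "\<exists>K::nat. h \<in> span (translates_between F (- int K) (int K))"
  using assms
proof (induction rule: span_induct_alt)
  case base
  show ?case by (simp add: span_zero)
next
  case (step c x y)
  obtain k f where x: "x = translate k f" "f \<in> F" using step(1) by (auto simp: translates_eq)
  obtain K :: nat where K: "y \<in> span (translates_between F (- int K) (int K))" using step by blast
  define K' where "K' = max K (nat \<bar>k\<bar>)"
  have "x \<in> translates_between F (- int K') (int K')"
    unfolding translates_between_def using x
    by (intro image_eqI[of _ _ "(f, k)"]) (auto simp: K'_def)
  moreover have "y \<in> span (translates_between F (- int K') (int K'))"
    using K span_mono[OF translates_between_mono[of "- int K'" "- int K" "int K" "int K'" F]]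
    by (auto simp: K'_def)
  ultimately have "c *\<^sub>R x + y \<in> span (translates_between F (- int K') (int K'))"
    by (intro span_add span_scale) (auto intro: span_base)
  then show ?case by blast
qed

lemma span_translates_between_finite:
  assumes "finite H" "H \<subseteq> span (translates T F)"
  shows "\<exists>K::nat. H \<subseteq> span (translates_between F (- int K) (int K))"
  using assms
proof (induction H rule: finite_induct)
  case (insert h H)
  obtain K :: nat where K: "H \<subseteq> span (translates_between F (- int K) (int K))"
    using insert by blast
  obtain K' :: nat where K': "h \<in> span (translates_between F (- int K') (int K'))"
    using span_translates_bounded insert.prems by blast
  define L where "L = max K K'"
  have "span (translates_between F (- int K) (int K)) \<subseteq> span (translates_between F (- int L) (int L))"
    "span (translates_between F (- int K') (int K')) \<subseteq> span (translates_between F (- int L) (int L))"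
    by (intro span_mono translates_between_mono; simp add: L_def)+
  then show ?case using K K' by blast
qed simp

text \<open>Forward shifts by at most \<open>n\<close> keep the window inside one that is extended
  by \<open>n\<close> on the right.\<close>

lemma translate_span:
  assumes "h \<in> span (translates_between F a b)" "0 \<le> j" "j \<le> n"
  shows "translate j h \<in> span (translates_between F a (b + n))"
proof -
  have "translate j h \<in> span (translate j ` translates_between F a b)"
    using assms(1) linear_span_image[OF linear_translate[of j], of "translates_between F a b"] by blast
  moreover have "translate j ` translates_between F a b \<subseteq> translates_between F a (b + n)"
    using assms(2,3) by (fastforce simp: translates_between_def translate_translate)
  ultimately show ?thesis using span_mono by blast
qed

lemma product_bcontfun:
  fixes g :: "'a \<Rightarrow>\<^sub>C real"
  shows "\<exists>q::'a \<Rightarrow>\<^sub>C real. \<forall>x. apply_bcontfun q x = g x * g ((T ^^ s) x)"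
proof -
  have "continuous_on UNIV (\<lambda>x. g x * translate (int s) g x)"
    by (intro continuous_on_mult continuous_on_apply_bcontfun)
  moreover have "norm (g x * translate (int s) g x) \<le> norm g * norm g" for x
    unfolding norm_mult using norm_bounded[of g]
    by (intro mult_mono) (auto simp del: real_norm_def)
  ultimately have "(\<lambda>x. g x * translate (int s) g x) \<in> bcontfun" by (rule bcontfun_normI)
  then obtain q where "(\<lambda>x. g x * translate (int s) g x) = apply_bcontfun q" by (rule bcontfunE)
  then show ?thesis by (intro exI[of _ q]) (simp add: fun_eq_iff)
qed

text \<open>On the points realising all sign patterns on \<open>W\<close>, the translates of the products
  \<open>g \<cdot> (g \<circ> T\<^sup>s)\<close> are distinct Walsh functions, hence orthonormal, and every one of them is
  close to the span of the given translates.\<close>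
lemma independence_dimension_bound:
  fixes g :: "'a \<Rightarrow>\<^sub>C real" and K L n :: nat
  assumes F: "finite F" and W: "W \<subseteq> {..<n}"
    and ind: "\<forall>V\<subseteq>W. \<exists>x. \<forall>j\<in>W. g ((T ^^ j) x) = (if j \<in> V then 1 else -1)"
    and q: "\<And>s x. apply_bcontfun (q s) x = g x * g ((T ^^ s) x)"
    and h: "\<And>s. s < L \<Longrightarrow> h s \<in> span (translates_between F (- int K) (int K))"
      "\<And>s. s < L \<Longrightarrow> dist (h s) (q s) \<le> 1/2"
  shows "3/4 * real (card {(u,v). u \<in> W \<and> v \<in> W \<and> u < v \<and> v < u + L}) \<le> real (card F * (n + 2 * K + 1))"
proof -
  define P where "P = {(u,v). u \<in> W \<and> v \<in> W \<and> u < v \<and> v < u + L}"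
  have finW: "finite W" using W finite_subset by blast
  have finP: "finite P" by (rule finite_subset[of _ "W \<times> W"]) (use finW in \<open>auto simp: P_def\<close>)
  have "\<forall>V. \<exists>x. V \<subseteq> W \<longrightarrow> (\<forall>j\<in>W. g ((T ^^ j) x) = sign_in V j)"
    using ind unfolding sign_in_def by blast
  then obtain p where p: "\<And>V j. V \<subseteq> W \<Longrightarrow> j \<in> W \<Longrightarrow> g ((T ^^ j) (p V)) = sign_in V j"
    by (subst (asm) choice_iff) blast
  define ip where "ip \<phi> \<psi> = (\<Sum>V\<in>Pow W. apply_bcontfun \<phi> (p V) * apply_bcontfun \<psi> (p V)) / 2 ^ card W" for \<phi> \<psi> :: "'a \<Rightarrow>\<^sub>C real"
  interpret semi_inner ip
    unfolding ip_def by (rule semi_inner_points) simp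
  \<comment> \<open>This is the product of \<open>g\<close> at times \<open>u\<close> and
    \<open>v\<close>. Up to translation it depends only on the gap \<open>v - u\<close>, which is
    below \<open>L\<close>, so the approximants \<open>h s\<close> with \<open>s < L\<close> serve
    all pairs.\<close>
  define e where "e = (\<lambda>(u, v). translate (int u) (q (v - u)))"
  have e: "e (u, v) (p V) = sign_in V u * sign_in V v" if "(u, v) \<in> P" "V \<subseteq> W" for u v V
  proof -
    have "(T ^^ (v - u)) ((T ^^ u) (p V)) = (T ^^ v) (p V)"
      using that(1) by (auto simp: P_def simp flip: funpow_add[THEN fun_cong, unfolded o_apply])
    then show ?thesis using that p by (simp add: e_def q P_def)
  qed
  \<comment> \<open>The error 1/4 is the square of the uniform distance 1/2.\<close>
  have "real (card P) * (1 - 1/4) \<le> real (card (translates_between F (- int K) (int K + int n)))"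
  proof (rule orthonormal_near_span[OF finP, of e])
    fix a b assume ab: "a \<in> P" "b \<in> P"
    obtain u v u' v' where uv: "a = (u, v)" "b = (u', v')" by (cases a, cases b) auto
    have "(\<Sum>V\<in>Pow W. e a (p V) * e b (p V))
      = (\<Sum>V\<in>Pow W. (sign_in V u * sign_in V v) * (sign_in V u' * sign_in V v'))"
      using ab e unfolding uv by (intro sum.cong) auto
    also have "\<dots> = (if a = b then 2 ^ card W else 0)"
      unfolding uv using ab by (intro sum_sign_in_pairs[OF finW]) (auto simp: P_def uv)
    finally show "ip (e a) (e b) = (if a = b then 1 else 0)" by (simp add: ip_def)
  next
    show "finite (translates_between F (- int K) (int K + int n))"
      by (rule finite_translates_between[OF F])
  next
    fix a assume a: "a \<in> P"
    obtain u v where uv: "a = (u, v)" by (cases a)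
    define s where "s = v - u"
    have s: "s < L" and u: "u < n" using a W by (auto simp: s_def uv P_def)
    define w where "w = translate (int u) (h s)"
    have "w \<in> span (translates_between F (- int K) (int K + int n))"
      unfolding w_def using u by (intro translate_span[OF h(1)[OF s]]) auto
    moreover have "ip (e a - w) (e a - w) \<le> 1/4"
    proof -
      have "(e a - w) x * (e a - w) x \<le> 1/4" for x
      proof -
        have "(e a - w) x = q s ((T ^^ u) x) - h s ((T ^^ u) x)" by (simp add: e_def uv w_def s_def)
        also have "\<bar>\<dots>\<bar> \<le> 1/2"
          using dist_bounded[of "h s" "(T ^^ u) x" "q s"] h(2)[OF s]
          by (simp add: dist_real_def abs_minus_commute)
        finally have "\<bar>(e a - w) x\<bar> * \<bar>(e a - w) x\<bar> \<le> 1/2 * (1/2)" by (intro mult_mono) auto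
        then show ?thesis by simp
      qed
      then have "(\<Sum>V\<in>Pow W. (e a - w) (p V) * (e a - w) (p V)) \<le> (\<Sum>V\<in>Pow W. 1/4)"
        by (intro sum_mono)
      also have "\<dots> = 2 ^ card W / 4" using finW by (simp add: card_Pow)
      finally show ?thesis by (simp add: ip_def divide_le_eq)
    qed
    ultimately show "\<exists>w\<in>span (translates_between F (- int K) (int K + int n)). ip (e a - w) (e a - w) \<le> 1/4"
      by blast
  qed
  also have "real (card (translates_between F (- int K) (int K + int n))) \<le> real (card F * (n + 2 * K + 1))"
  proof -
    have "nat (int K + int n - - int K + 1) = n + 2 * K + 1" by simp
    then show ?thesis using card_translates_between[OF F, of "- int K" "int K + int n"]
      by (metis of_nat_le_iff)
  qed
  finally show ?thesis by (simp add: P_def mult.commute)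
qed

text \<open>Close pairs against dimension: with \<open>N = card F\<close> there are at least
  \<open>(2 * N + 3) * n - (n + L)\<close> pairs, while the dimension bound allows about
  \<open>4/3 * N * n\<close>. The constants \<open>r\<close>, \<open>L\<close> and \<open>K\<close>
  are fixed before \<open>n\<close>.\<close>

lemma no_frequent_independence:
  fixes d :: real and G :: "('a \<Rightarrow>\<^sub>C real) set"
  assumes F: "finite F" "closure (span (translates T F)) = UNIV"
    and G: "finite G" and d: "d > 0"
  shows "\<not> (\<exists>\<^sub>F n in sequentially. \<exists>g\<in>G. \<exists>W\<subseteq>{..<n}. real (card W) > d * n \<and>
      (\<forall>V\<subseteq>W. \<exists>x. \<forall>j\<in>W. apply_bcontfun g ((T ^^ j) x) = (if j \<in> V then 1 else -1)))"
proof
  define N where "N = card F"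
  define r where "r = nat \<lceil>(2 * N + 3) / d\<rceil>"
  have r: "r * d \<ge> 2 * N + 3"
  proof -
    have "(2 * N + 3) / d \<le> r" unfolding r_def by linarith
    then show ?thesis using d by (simp add: field_simps)
  qed
  then have r0: "r > 0" by (cases r) auto
  \<comment> \<open>Makes the error term \<open>r * r * (n div L + 1)\<close> of
    \<open>close_pairs\<close> at most \<open>n + L\<close>.\<close>
  define L where "L = r * r"
  have L0: "L > 0" using r0 by (simp add: L_def)
  have "\<exists>q. \<forall>x. apply_bcontfun q x = g x * g ((T ^^ s) x)" for g :: "'a \<Rightarrow>\<^sub>C real" and s
    using product_bcontfun by blast
  then obtain q :: "('a \<Rightarrow>\<^sub>C real) \<Rightarrow> nat \<Rightarrow> 'a \<Rightarrow>\<^sub>C real"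
    where q: "\<And>g s x. apply_bcontfun (q g s) x = g x * g ((T ^^ s) x)" by metis
  have "\<exists>h\<in>span (translates T F). dist h (q g s) < 1/2" for g s
  proof -
    have "q g s \<in> closure (span (translates T F))" by (simp add: F(2))
    from closure_approachable[THEN iffD1, rule_format, OF this, of "1/2"] show ?thesis by simp
  qed
  then obtain h where h: "\<And>g s. h g s \<in> span (translates T F)" "\<And>g s. dist (h g s) (q g s) < 1/2"
    by metis
  \<comment> \<open>One window serves all the approximants, as only finitely many \<open>g\<close>
    and gaps \<open>s\<close> occur.\<close>
  have "\<exists>K::nat. (\<lambda>(g, s). h g s) ` (G \<times> {..<L}) \<subseteq> span (translates_between F (- int K) (int K))"
    by (rule span_translates_between_finite) (use G h(1) in auto)
  then obtain K :: nat where
    K: "(\<lambda>(g, s). h g s) ` (G \<times> {..<L}) \<subseteq> span (translates_between F (- int K) (int K))" by blast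
  assume "\<exists>\<^sub>F n in sequentially. \<exists>g\<in>G. \<exists>W\<subseteq>{..<n}. real (card W) > d * n \<and>
      (\<forall>V\<subseteq>W. \<exists>x. \<forall>j\<in>W. apply_bcontfun g ((T ^^ j) x) = (if j \<in> V then 1 else -1))"
  moreover have "\<forall>\<^sub>F n::nat in sequentially. n \<ge> 2 * L + 2 * N * (2 * K + 1)"
    by (rule eventually_ge_at_top)
  ultimately have "\<exists>\<^sub>F n in sequentially. False"
  proof (rule frequently_rev_mp[OF _ eventually_mono])
    fix n assume n: "n \<ge> 2 * L + 2 * N * (2 * K + 1)"
    show "(\<exists>g\<in>G. \<exists>W\<subseteq>{..<n}. real (card W) > d * n \<and>
      (\<forall>V\<subseteq>W. \<exists>x. \<forall>j\<in>W. apply_bcontfun g ((T ^^ j) x) = (if j \<in> V then 1 else -1))) \<longrightarrow> False"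
    proof (intro impI, elim bexE exE conjE)
      fix g W assume g: "g \<in> G" and W: "W \<subseteq> {..<n}" "real (card W) > d * n"
        and ind: "\<forall>V\<subseteq>W. \<exists>x. \<forall>j\<in>W. apply_bcontfun g ((T ^^ j) x) = (if j \<in> V then 1 else -1)"
      let ?P = "{(u,v). u \<in> W \<and> v \<in> W \<and> u < v \<and> v < u + L}"
      have arith: "3/4 * a \<le> 3/4 * b + c" if "3/4 * p \<le> c" "a \<le> p + b" for a b c p :: real
        using that by linarith
      have "3/4 * real (card ?P) \<le> real (N * (n + 2 * K + 1))"
        unfolding N_def
      proof (rule independence_dimension_bound[OF F(1) W(1) ind q])
        show "h g s \<in> span (translates_between F (- int K) (int K))" if "s < L" for s
          using K g that by force
        show "dist (h g s) (q g s) \<le> 1/2" for s using h(2)[of g s] by simp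
      qed
      moreover have "real (r * card W) \<le> real (card ?P + (n + L))"
      proof -
        have "r * r * (n div L + 1) \<le> n + L" using L0 by (simp add: L_def)
        then have "r * card W \<le> card ?P + (n + L)"
          using close_pairs[OF W(1) L0, of r] by linarith
        then show ?thesis by (rule of_nat_mono)
      qed
      ultimately have *: "3/4 * (real r * card W) \<le> 3/4 * (real n + L) + real (N * (n + 2 * K + 1))"
        unfolding of_nat_mult[of r] of_nat_add[of "card ?P"] of_nat_add[of n L] by (rule arith)
      have "(2 * N + 3) * real n \<le> r * d * n"
        using r by (intro mult_right_mono) auto
      also have "\<dots> \<le> real r * card W"
        using W(2) by (simp add: mult.assoc mult_left_mono)
      finally have "3/4 * ((2 * N + 3) * real n) \<le> 3/4 * (real n + L) + real (N * (n + 2 * K + 1))"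
        using * by linarith
      \<comment> \<open>The left side grows with \<open>n\<close> and the right side is constant;
        the lower bound on \<open>n\<close> fixed above exceeds what this allows.\<close>
      then have "real N * n / 2 + 3/2 * n \<le> 3/4 * L + N * (2 * K + 1)"
        by (simp add: algebra_simps add_divide_distrib)
      moreover have "real n \<ge> 2 * L + 2 * (N * (2 * K + 1))"
        using n by (simp add: of_nat_le_iff[symmetric, where 'a = real] algebra_simps del: of_nat_le_iff)
      moreover have "L \<ge> 1" using L0 by simp
      moreover have "0 \<le> real N * n / 2" "0 \<le> real (N * (2 * K + 1))" by simp_all
      ultimately show False by linarith
    qed
  qed
  then show False by simp
qed

end

theorem mainTheorem1:
  fixes T :: "'a::topological_space \<Rightarrow> 'a"
  assumes "compact (UNIV :: 'a set)"
    and "metrizable_space (euclidean :: 'a topology)"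
    and "homeomorphic_map euclidean euclidean T"
    and "top_mult T < \<infinity>"
  shows "top_entropy T = 0 \<and> finite {\<mu>. ergodic_borel_prob T \<mu>}"
proof -
  interpret homeomorphism_system T by unfold_locales (fact assms(3))
  \<comment> \<open>An infimum below infinity has a finite member, since infinite sets contribute
    the value infinity.\<close>
  obtain F where F: "finite F" "closure (span (translates T F)) = UNIV"
    using assms(4) unfolding top_mult_def INF_less_iff by (auto split: if_splits)
  have "cover_entropy T \<U> \<le> 0" if \<U>: "open_cover \<U>" for \<U>
  proof (rule ccontr)
    assume "\<not> cover_entropy T \<U> \<le> 0"
    then have "cover_entropy T \<U> > 0" by simp
    then obtain G :: "('a \<Rightarrow>\<^sub>C real) set" and d :: real where "finite G" "d > 0"
      "\<exists>\<^sub>F n in sequentially. \<exists>g\<in>G. \<exists>W\<subseteq>{..<n}. real (card W) > d * n \<and>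
        (\<forall>V\<subseteq>W. \<exists>x. \<forall>j\<in>W. apply_bcontfun g ((T ^^ j) x) = (if j \<in> V then 1 else -1))"
      by (rule positive_entropy_independence[OF assms(1,2) \<U>])
    then show False using no_frequent_independence[OF F] by blast
  qed
  then have "top_entropy T \<le> 0"
    unfolding top_entropy_def by (intro SUP_least) auto
  moreover have "0 \<le> top_entropy T"
  proof -
    \<comment> \<open>This includes \<open>k = 0\<close>, by the default value
      \<open>ln 0 = 0\<close>; the trivial cover then shows that the supremum is
      nonnegative.\<close>
    have ln_nonneg: "0 \<le> ln (real k)" for k by (cases k) auto
    have "open_cover {UNIV :: 'a set}" by (simp add: open_cover_def)
    moreover have "0 \<le> cover_entropy T {UNIV}"
      unfolding cover_entropy_def using ln_nonneg
      by (intro le_Limsup always_eventually allI) auto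
    ultimately show ?thesis
      unfolding top_entropy_def by (meson SUP_upper2 mem_Collect_eq)
  qed
  ultimately show ?thesis using finite_ergodic[OF assms(2) F] by simp
qed

end
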